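(* (i) The space $\mathfrak{krv}_{ell}$ is bigraded for the weight and the depth. (ii) For each $b\in\mathfrak{krv}_{ell}$ there exists a unique $a\in\mathfrak{lie}_C$ (the partner of $b$) such that the derivation $D_{b,a}$ lies in $\mathfrak{oder}_2$. (iii) The image of the injective linear map $b\mapsto D_{b,a}$ is a Lie subalgebra of $\mathfrak{oder}_2$; equivalently, $\mathfrak{krv}_{ell}$ is a Lie algebra under the bracket $\langle b,b'\rangle=D_{b,a}(b')-D_{b',a'}(b)$, where $a,a'$ are the partners of $b,b'$.
   Context: Let $\mathfrak{lie}_2$ be the degree-completed free Lie algebra over $\mathbb{Q}$ on $x,y$ (weight = degree, depth = $y$-degree), $C_i=\mathrm{ad}(x)^{i-1}(y)$, and $\mathfrak{lie}_C$ the completed free Lie algebra on the $C_i$ inside $\mathfrak{lie}_2$. For $b,a\in\mathfrak{lie}_2$, $D_{b,a}$ is the derivation with $x\mapsto b$, $y\mapsto a$. $\mathfrak{oder}_2$ is the Lie algebra (under commutator) of derivations $D$ of $\mathfrak{lie}_2$ with $D([x,y])=0$ and such that neither $D(x)$ nor $D(y)$ has a linear term in $x$. Moulds: a mould is a family $A=(A^r)_{r\ge0}$ with $A^r\in\mathbb{Q}(u_1,\dots,u_r)$; $ARI$ is the space of moulds with $A^0=0$; $\overline{ARI}$ is the same in variables $v_1,v_2,\dots$. A constant-valued mould is one with each $A^r$ a constant. $swap:ARI\to\overline{ARI}$, $swap(A)(v_1,\dots,v_r)=A(v_r,v_{r-1}-v_r,\dots,v_1-v_2)$. $A\in ARI$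 is push-invariant if $A(u_0,u_1,\dots,u_{r-1})=A(u_1,\dots,u_r)$ for all $r\ge1$, with $u_0=-u_1-\dots-u_r$. $B\in\overline{ARI}$ is circ-neutral if $\sum_{i=0}^{r-1}B(v_{i+1},\dots,v_r,v_1,\dots,v_i)=0$ for all $r>1$. For $b\in\mathfrak{lie}_C$ write its depth-$r$ part uniquely as $\sum k_{\underline a}C_{a_1}\cdots C_{a_r}$ and set $B^r(u_1,\dots,u_r)=\sum k_{\underline a}u_1^{a_1-1}\cdots u_r^{a_r-1}$, $B_*^r=B^r/(u_1\cdots u_r(u_1+\dots+u_r))$, and $B_*=(B_*^r)_r\in ARI$. Then $\mathfrak{krv}_{ell}$ is the space of $b\in\mathfrak{lie}_C$ such that $B_*$ is push-invariant and there is a constant-valued mould $M_0$ with $swap(B_* )+M_0$ circ-neutral. *)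

theory Defs
  imports Complex_Main
begin

text \<open>A word in x,y is a bool list: False stands for x, True for y.
  A (formal, degree-completed) series is a function from words to rationals.
  Weight = length of a word, depth = number of y's in it.\<close>

type_synonym word = "bool list"
type_synonym ser = "word \<Rightarrow> rat"

definition szero :: ser where "szero = (\<lambda>w. 0)"
definition sadd :: "ser \<Rightarrow> ser \<Rightarrow> ser" where "sadd f g = (\<lambda>w. f w + g w)"
definition ssub :: "ser \<Rightarrow> ser \<Rightarrow> ser" where "ssub f g = (\<lambda>w. f w - g w)"
definition ssc :: "rat \<Rightarrow> ser \<Rightarrow> ser" where "ssc c f = (\<lambda>w. c * f w)"
definition smono :: "word \<Rightarrow> ser" where "smono u = (\<lambda>w. if w = u then 1 else 0)"

definition smul :: "ser \<Rightarrow> ser \<Rightarrow> ser" where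
  "smul f g = (\<lambda>w. \<Sum>k\<le>length w. f (take k w) * g (drop k w))"

definition sbr :: "ser \<Rightarrow> ser \<Rightarrow> ser" where "sbr f g = ssub (smul f g) (smul g f)"

definition sX :: ser where "sX = smono [False]"
definition sY :: ser where "sY = smono [True]"

definition hom :: "nat \<Rightarrow> ser \<Rightarrow> ser" where
  "hom n f = (\<lambda>w. if length w = n then f w else 0)"
definition bihom :: "nat \<Rightarrow> nat \<Rightarrow> ser \<Rightarrow> ser" where
  "bihom n r f = (\<lambda>w. if length w = n \<and> count_list w True = r then f w else 0)"

inductive_set liepoly :: "ser set" where
  lp_X: "sX \<in> liepoly"
| lp_Y: "sY \<in> liepoly"
| lp_add: "f \<in> liepoly \<Longrightarrow> g \<in> liepoly \<Longrightarrow> sadd f g \<in> liepoly"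
| lp_sc: "f \<in> liepoly \<Longrightarrow> ssc c f \<in> liepoly"
| lp_br: "f \<in> liepoly \<Longrightarrow> g \<in> liepoly \<Longrightarrow> sbr f g \<in> liepoly"

definition lie2 :: "ser set" where "lie2 = {f. \<forall>n. hom n f \<in> liepoly}"

definition C :: "nat \<Rightarrow> ser" where "C i = ((\<lambda>f. sbr sX f) ^^ (i - 1)) sY"

inductive_set lieCpoly :: "ser set" where
  lc_C: "1 \<le> i \<Longrightarrow> C i \<in> lieCpoly"
| lc_add: "f \<in> lieCpoly \<Longrightarrow> g \<in> lieCpoly \<Longrightarrow> sadd f g \<in> lieCpoly"
| lc_sc: "f \<in> lieCpoly \<Longrightarrow> ssc c f \<in> lieCpoly"
| lc_br: "f \<in> lieCpoly \<Longrightarrow> g \<in> lieCpoly \<Longrightarrow> sbr f g \<in> lieCpoly"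

definition lieC :: "ser set" where "lieC = {f. \<forall>n. hom n f \<in> lieCpoly}"

definition Cmon :: "nat list \<Rightarrow> ser" where
  "Cmon a = foldr (\<lambda>i acc. smul (C i) acc) a (smono [])"

definition comps :: "nat \<Rightarrow> nat \<Rightarrow> nat list set" where
  "comps n r = {a. length a = r \<and> (\<forall>i\<in>set a. 1 \<le> i) \<and> sum_list a = n}"

text \<open>The coefficient k_a of C_{a1}...C_{ar} in the (unique) expansion of the
  weight (a1+...+ar), depth r part of b.\<close>
definition Ccoeff :: "ser \<Rightarrow> nat list \<Rightarrow> rat" where
  "Ccoeff b a = (THE k. (\<forall>a'. a' \<notin> comps (sum_list a) (length a) \<longrightarrow> k a' = 0) \<and>
       bihom (sum_list a) (length a) b =
         (\<lambda>w. \<Sum>a'\<in>comps (sum_list a) (length a). k a' * Cmon a' w)) a"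

text \<open>Weight-n component of B^r, evaluated at the point us = [u_1,...,u_r].\<close>
definition Bmould :: "ser \<Rightarrow> nat \<Rightarrow> nat \<Rightarrow> rat list \<Rightarrow> rat" where
  "Bmould b n r us = (\<Sum>a\<in>comps n r. Ccoeff b a * (\<Prod>i<r. (us ! i) ^ (a ! i - 1)))"

definition Bstar :: "ser \<Rightarrow> nat \<Rightarrow> nat \<Rightarrow> rat list \<Rightarrow> rat" where
  "Bstar b n r us = Bmould b n r us / (prod_list us * sum_list us)"

text \<open>Points where the denominator of B_* does not vanish.\<close>
definition good :: "rat list \<Rightarrow> bool" where
  "good us \<longleftrightarrow> (\<forall>x\<in>set us. x \<noteq> 0) \<and> sum_list us \<noteq> 0"

definition swap_pt :: "rat list \<Rightarrow> rat list" where
  "swap_pt vs = map (\<lambda>j. if j = 0 then vs ! (length vs - 1)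
                        else vs ! (length vs - 1 - j) - vs ! (length vs - j)) [0..<length vs]"

text \<open>Push-invariance of B_* (checked on each weight component, at every point
  where denominators do not vanish): B_*(u_0,u_1,...,u_{r-1}) = B_*(u_1,...,u_r).\<close>
definition push_inv :: "ser \<Rightarrow> bool" where
  "push_inv b \<longleftrightarrow> (\<forall>n r us. 1 \<le> r \<longrightarrow> length us = r \<longrightarrow> good us \<longrightarrow>
      Bstar b n r ((- sum_list us) # butlast us) = Bstar b n r us)"

text \<open>There is a constant-valued mould M_0 with swap(B_* ) + M_0 circ-neutral.
  The constant M_0^r is homogeneous of degree 0, which is the degree of the
  weight (2r+1) component of swap(B_* )^r.\<close>
definition circ_ok :: "ser \<Rightarrow> bool" where
  "circ_ok b \<longleftrightarrow> (\<exists>M0 :: nat \<Rightarrow> rat. \<forall>r n vs. 1 < r \<longrightarrow> length vs = r \<longrightarrow>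
      (\<forall>i<r. good (swap_pt (rotate i vs))) \<longrightarrow>
      (\<Sum>i<r. Bstar b n r (swap_pt (rotate i vs)))
        + (if n = 2 * r + 1 then of_nat r * M0 r else 0) = 0)"

definition krv_ell :: "ser set" where
  "krv_ell = {b. b \<in> lieC \<and> push_inv b \<and> circ_ok b}"

definition gen :: "ser \<Rightarrow> ser \<Rightarrow> bool \<Rightarrow> ser" where
  "gen b a c = (if c then a else b)"

definition der_word :: "ser \<Rightarrow> ser \<Rightarrow> word \<Rightarrow> ser" where
  "der_word b a w = (\<lambda>v. \<Sum>i<length w.
      smul (smono (take i w)) (smul (gen b a (w ! i)) (smono (drop (Suc i) w))) v)"

text \<open>D_{b,a}, extended by continuity (b, a without constant term).\<close>
definition der :: "ser \<Rightarrow> ser \<Rightarrow> ser \<Rightarrow> ser" where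
  "der b a f = (\<lambda>v. \<Sum>w\<in>{w. length w \<le> length v}. f w * der_word b a w v)"

definition is_oder2 :: "(ser \<Rightarrow> ser) \<Rightarrow> bool" where
  "is_oder2 D \<longleftrightarrow> (\<exists>b a. b \<in> lie2 \<and> a \<in> lie2 \<and> b [False] = 0 \<and> a [False] = 0 \<and>
      (\<forall>f\<in>lie2. D f = der b a f) \<and> D (sbr sX sY) = szero)"

definition partner :: "ser \<Rightarrow> ser" where
  "partner b = (THE a. a \<in> lieC \<and> is_oder2 (der b a))"

definition Phi :: "ser \<Rightarrow> ser \<Rightarrow> ser" where
  "Phi b = der b (partner b)"

definition kbr :: "ser \<Rightarrow> ser \<Rightarrow> ser" where
  "kbr b b' = ssub (der b (partner b) b') (der b' (partner b') b)"

end

theory Submission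
  imports Defs "HOL-Library.Function_Algebras" "HOL-Computational_Algebra.Polynomial"
begin

text \<open>
  Write a word of depth \<open>r\<close> as \<open>x^e\<^sub>0 y x^e\<^sub>1 y \<dots> y x^e\<^sub>r\<close> and encode it as the monomial
  \<open>z\<^sub>0^e\<^sub>0 \<dots> z\<^sub>r^e\<^sub>r\<close>. Then the mould of \<open>b\<close> at \<open>u\<^sub>i = z\<^sub>i\<^sub>-\<^sub>1 - z\<^sub>i\<close> is the generating function of the
  coefficients of \<open>b\<close>, and push-invariance says that these coefficients are invariant under
  cyclic rotation of \<open>(e\<^sub>0, \<dots>, e\<^sub>r)\<close>. This is exactly the solvability of \<open>[x,a] = [y,b]\<close> among
  associative series; a Dynkin operator that counts the depth and commutes with \<open>ad x\<close> replaces
  a solution by a Lie one, the partner.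

  In terms of words, \<open>a(wy) = -b(xw)\<close>, so the divergence of \<open>D\<^sub>b\<^sub>,\<^sub>a\<close>, a series of cyclic words, is
  given by \<open>b(wx) - b(xw)\<close>. Multiplying the circ-neutrality relation by the rotation invariant
  product \<open>(z\<^sub>1 - z\<^sub>2) \<dots> (z\<^sub>r - z\<^sub>1)\<close> turns it into the statement that the divergence is a combination
  of the cyclic words \<open>[x,y]^r\<close>, the coefficients being the constants of the mould \<open>M\<^sub>0\<close>. Since the
  divergence is a 1-cocycle and \<open>D\<^sub>b\<^sub>,\<^sub>a\<close> kills \<open>[x,y]\<close>, commutators have divergence zero.
\<close>

text \<open>The moulds are available only through their values at rational points off the zeros of
  the denominators. Identities are therefore obtained at generic points and extended along lines, on
  which they are polynomial in one parameter. The substitution \<open>u_i = z_(i-1) - z_i\<close> is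
  forced by \<open>C_i = ad(x)^(i-1)(y)\<close>: an x before the y counts for one variable, an x
  behind it for the next, so ad x multiplies by their difference. The denominator of
  \<open>B_*\<close> consists of the consecutive differences and of \<open>z_0 - z_r\<close>, which
  closes the cycle; this is why dividing by it preserves rotation symmetry. The swap sets
  \<open>z_0 = 0\<close>, so circ-neutrality only sees words that begin with y. This suffices,
  because every cyclic word containing y has such a representative. The constants of
  \<open>M_0\<close> correspond to powers of \<open>[x,y] = C_2\<close> because the mould of
  \<open>[x,y]^r\<close> is \<open>u_1 ... u_r\<close>. In passing to the bracket, circ-neutrality
  enters with arbitrary constants, and the result comes out with divergence zero, hence with
  constants zero.\<close>

lemma sadd_eq: "sadd f g = f + g" by (simp add: sadd_def fun_eq_iff)
lemma ssub_eq: "ssub f g = f - g" by (simp add: ssub_def fun_eq_iff)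
lemma szero_eq: "szero = 0" by (simp add: szero_def fun_eq_iff)
lemma sbr_eq: "sbr f g = smul f g - smul g f" by (simp add: sbr_def ssub_eq)

lemma ssc_apply [simp]: "ssc c f w = c * f w" by (simp add: ssc_def)
lemma smono_apply: "smono u w = (if w = u then 1 else 0)" by (simp add: smono_def)

lemma sum_apply: "(\<Sum>i\<in>I. F i) w = (\<Sum>i\<in>I. F i w)" for F :: "'i \<Rightarrow> ser"
  by (induction I rule: infinite_finite_induct) auto

section \<open>Concatenation of series, and stripping the first or last letter\<close>

definition lder :: "bool \<Rightarrow> ser \<Rightarrow> ser" where "lder c f = (\<lambda>w. f (c # w))"
definition rder :: "bool \<Rightarrow> ser \<Rightarrow> ser" where "rder c f = (\<lambda>w. f (w @ [c]))"

lemma lder_apply [simp]: "lder c f w = f (c # w)" by (simp add: lder_def)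
lemma rder_apply [simp]: "rder c f w = f (w @ [c])" by (simp add: rder_def)

lemma smul_Nil [simp]: "smul f g [] = f [] * g []" by (simp add: smul_def)

lemma smul_Cons: "smul f g (c # w) = f [] * g (c # w) + smul (lder c f) g w"
  by (simp add: smul_def sum.atMost_Suc_shift del: sum.atMost_Suc)

lemma smul_snoc: "smul f g (w @ [c]) = smul f (rder c g) w + f (w @ [c]) * g []"
  by (simp add: smul_def)

lemma smul_add_left: "smul (f + g) h = smul f h + smul g h"
  by (simp add: smul_def fun_eq_iff sum.distrib algebra_simps)
lemma smul_add_right: "smul h (f + g) = smul h f + smul h g"
  by (simp add: smul_def fun_eq_iff sum.distrib algebra_simps)
lemma smul_diff_left: "smul (f - g) h = smul f h - smul g h"
  by (simp add: smul_def fun_eq_iff sum_subtractf algebra_simps)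
lemma smul_diff_right: "smul h (f - g) = smul h f - smul h g"
  by (simp add: smul_def fun_eq_iff sum_subtractf algebra_simps)
lemma smul_uminus_left: "smul (- f) h = - smul f h"
  by (simp add: smul_def fun_eq_iff sum_negf)
lemma smul_uminus_right: "smul h (- f) = - smul h f"
  by (simp add: smul_def fun_eq_iff sum_negf)
lemma smul_zero [simp]: "smul 0 h = 0" "smul h 0 = 0"
  by (simp_all add: smul_def fun_eq_iff)
lemma smul_ssc: "smul (ssc c f) h = ssc c (smul f h)" "smul h (ssc c f) = ssc c (smul h f)"
  by (simp_all add: smul_def fun_eq_iff sum_distrib_left algebra_simps)
lemma smul_sum_left: "smul (\<Sum>i\<in>I. F i) h = (\<Sum>i\<in>I. smul (F i) h)" for F :: "'i \<Rightarrow> ser"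
  by (auto simp: fun_eq_iff smul_def sum_apply sum_distrib_right intro: sum.swap)
lemma smul_sum_right: "smul h (\<Sum>i\<in>I. F i) = (\<Sum>i\<in>I. smul h (F i))" for F :: "'i \<Rightarrow> ser"
  by (auto simp: fun_eq_iff smul_def sum_apply sum_distrib_left intro: sum.swap)

lemma ssc_simps: "ssc c (f + g) = ssc c f + ssc c g" "ssc c (f - g) = ssc c f - ssc c g"
  "ssc c (ssc d f) = ssc (c * d) f" "ssc c 0 = 0" "ssc 0 f = 0" "ssc 1 f = f"
  by (auto simp: fun_eq_iff algebra_simps)

lemmas smul_simps = smul_add_left smul_add_right smul_diff_left smul_diff_right
  smul_uminus_left smul_uminus_right smul_ssc ssc_simps

lemma lder_smul: "lder c (smul f g) = ssc (f []) (lder c g) + smul (lder c f) g"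
  by (simp add: fun_eq_iff smul_Cons)

lemma rder_smul: "rder c (smul f g) = smul f (rder c g) + ssc (g []) (rder c f)"
  by (simp add: fun_eq_iff smul_snoc)

lemma smul_assoc: "smul (smul f g) h = smul f (smul g h)"
proof
  fix w show "smul (smul f g) h w = smul f (smul g h) w"
    by (induction w arbitrary: f)
       (simp_all add: smul_Cons lder_smul smul_add_left smul_ssc algebra_simps)
qed

lemma smul_cong_le:
  assumes "\<And>u. length u \<le> length w \<Longrightarrow> f u = f' u" "\<And>u. length u \<le> length w \<Longrightarrow> g u = g' u"
  shows "smul f g w = smul f' g' w"
  unfolding smul_def by (rule sum.cong) (auto intro!: assms arg_cong2[where f="(*)"])

abbreviation sone :: ser where "sone \<equiv> smono []"
abbreviation ltr :: "bool \<Rightarrow> ser" where "ltr c \<equiv> smono [c]"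

lemma sX_eq: "sX = ltr False" by (simp add: sX_def)
lemma sY_eq: "sY = ltr True" by (simp add: sY_def)

lemma lder_smono: "lder c (smono []) = 0" "lder c (smono (d # u)) = (if c = d then smono u else 0)"
  by (auto simp: fun_eq_iff smono_apply)

lemma smul_one [simp]: "smul sone f = f" "smul f sone = f"
proof -
  have "smul sone f w = f w" for w
    by (cases w) (simp_all add: smul_Cons lder_smono smono_apply)
  then show "smul sone f = f" by (simp add: fun_eq_iff)
  have "smul f sone w = f w" for w
    by (induction w arbitrary: f) (simp_all add: smul_Cons smono_apply)
  then show "smul f sone = f" by (simp add: fun_eq_iff)
qed

lemma ltr_smul_Nil [simp]: "smul (ltr c) f [] = 0"
  by (simp add: smono_apply)
lemma ltr_smul_Cons [simp]: "smul (ltr c) f (d # w) = (if c = d then f w else 0)"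
  by (simp add: smul_Cons smono_apply lder_smono)
lemma smul_ltr_snoc [simp]: "smul f (ltr c) (w @ [d]) = (if c = d then f w else 0)"
proof -
  have "rder d (ltr c) = (if c = d then sone else 0)"
    by (auto simp: fun_eq_iff smono_apply)
  then show ?thesis by (simp add: smul_snoc smono_apply)
qed
lemma smul_ltr_Nil [simp]: "smul f (ltr c) [] = 0"
  by (simp add: smono_apply)

lemma smono_append: "smul (smono u) (smono v) = smono (u @ v)"
proof (induction u)
  case (Cons c u)
  have *: "smono (c # u) = smul (ltr c) (smono u)" for u
  proof
    fix w show "smono (c # u) w = smul (ltr c) (smono u) w" by (cases w) (auto simp: smono_apply)
  qed
  show ?case using Cons *[of u] *[of "u @ v"] by (metis append_Cons smul_assoc)
qed simp

lemma ser_decomp: "f = ssc (f []) sone + smul (ltr False) (lder False f) + smul (ltr True) (lder True f)"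
proof
  fix w show "f w = (ssc (f []) sone + smul (ltr False) (lder False f) + smul (ltr True) (lder True f)) w"
    by (cases w) (auto simp: smono_apply)
qed

lemma finite_words: "finite {w :: word. length w = n}" "finite {w :: word. length w \<le> n}"
  using finite_lists_length_eq[of "UNIV :: bool set" n] finite_lists_length_le[of "UNIV :: bool set" n]
  by simp_all

lemma words_Suc_le: "{w :: word. length w \<le> Suc n} =
   insert [] ((#) False ` {w. length w \<le> n} \<union> (#) True ` {w. length w \<le> n})"
proof -
  have "w \<in> {w. length w \<le> Suc n} \<longleftrightarrow>
    w \<in> insert [] ((#) False ` {w. length w \<le> n} \<union> (#) True ` {w. length w \<le> n})" for w :: word
    by (cases w; cases "hd w") auto
  then show ?thesis by blast
qed

lemma sum_words_Suc_le: 
  "(\<Sum>w | length w \<le> Suc n. h w) = h [] + (\<Sum>w | length w \<le> n. h (False # w)) + (\<Sum>w | length w \<le> n. h (True # w))"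
  for h :: "word \<Rightarrow> rat"
  unfolding words_Suc_le
  by (subst sum.insert, force simp: finite_words, force, subst sum.union_disjoint)
     (auto simp: finite_words sum.reindex)

lemma words_Suc_eq: "{w :: word. length w = Suc n} =
   (#) False ` {w. length w = n} \<union> (#) True ` {w. length w = n}"
proof -
  have "w \<in> {w. length w = Suc n} \<longleftrightarrow>
    w \<in> (#) False ` {w. length w = n} \<union> (#) True ` {w. length w = n}" for w :: word
    by (cases w; cases "hd w") auto
  then show ?thesis by blast
qed

lemma sum_words_Suc_eq: 
  "(\<Sum>w | length w = Suc n. h w) = (\<Sum>w | length w = n. h (False # w)) + (\<Sum>w | length w = n. h (True # w))"
  for h :: "word \<Rightarrow> rat"
  unfolding words_Suc_eq
  by (subst sum.union_disjoint) (auto simp: finite_words sum.reindex)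

section \<open>Derivations\<close>

lemma der_word_Nil: "der_word b a [] = 0"
  by (simp add: der_word_def fun_eq_iff)

lemma der_word_Cons:
  "der_word b a (c # w) = smul (gen b a c) (smono w) + smul (ltr c) (der_word b a w)"
proof
  fix v
  have "der_word b a (c # w) v = smul (gen b a c) (smono w) v +
     (\<Sum>i<length w. smul (smono (c # take i w)) (smul (gen b a (w ! i)) (smono (drop (Suc i) w))) v)"
    by (simp add: der_word_def sum.lessThan_Suc_shift del: sum.lessThan_Suc)
  also have "(\<Sum>i<length w. smul (smono (c # take i w)) (smul (gen b a (w ! i)) (smono (drop (Suc i) w))) v)
     = (\<Sum>i<length w. smul (ltr c) (smul (smono (take i w)) (smul (gen b a (w ! i)) (smono (drop (Suc i) w))))) v"
    by (simp add: sum_apply smul_assoc[symmetric] smono_append)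
  also have "(\<Sum>i<length w. smul (ltr c) (smul (smono (take i w)) (smul (gen b a (w ! i)) (smono (drop (Suc i) w)))))
     = smul (ltr c) (der_word b a w)"
    unfolding der_word_def smul_sum_right[symmetric] by (rule arg_cong2[where f=smul]) (auto simp: fun_eq_iff sum_apply)
  finally show "der_word b a (c # w) v = (smul (gen b a c) (smono w) + smul (ltr c) (der_word b a w)) v" by simp
qed

lemma smul_smono_le: "f [] = 0 \<Longrightarrow> length v \<le> length w \<Longrightarrow> smul f (smono w) v = 0"
proof -
  assume f: "f [] = 0" and le: "length v \<le> length w"
  have "f (take k v) * smono w (drop k v) = 0" for k
    using f le by (cases "k = 0"; cases v) (auto simp: smono_apply)
  then show ?thesis unfolding smul_def by (intro sum.neutral) blast
qed

text \<open>Replacing a letter by a series without constant term never shortens a word. Hence the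
  finite sum in \<open>der\<close> already contains every word that contributes to a given
  coefficient.\<close>

lemma der_word_short:
  assumes "b [] = 0" "a [] = 0" "length v < length w"
  shows "der_word b a w v = 0"
  using assms(3)
proof (induction w arbitrary: v)
  case (Cons c w)
  have "smul (gen b a c) (smono w) v = 0"
    using Cons.prems assms by (intro smul_smono_le) (auto simp: gen_def)
  moreover have "smul (ltr c) (der_word b a w) v = 0"
    using Cons by (cases v) (auto simp del: smul_Nil)
  ultimately show ?case by (simp add: der_word_Cons)
qed simp

lemma der_apply_bound:
  assumes "b [] = 0" "a [] = 0" "length v \<le> N"
  shows "der b a f v = (\<Sum>w | length w \<le> N. f w * der_word b a w v)"
  unfolding der_def using assms
  by (intro sum.mono_neutral_left) (auto simp: finite_words der_word_short)

lemma smul_expand: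
  assumes "f [] = 0" "length v \<le> Suc N"
  shows "smul f g v = (\<Sum>w | length w \<le> N. g w * smul f (smono w) v)"
proof -
  define g' where "g' = (\<Sum>w | length w \<le> N. ssc (g w) (smono w))"
  have g': "g' u = (if length u \<le> N then g u else 0)" for u
    by (simp add: g'_def sum_apply smono_apply finite_words if_distrib[of "\<lambda>x. _ * x"] cong: if_cong)
  have "smul f g v = smul f g' v"
    unfolding smul_def
  proof (rule sum.cong)
    fix k assume "k \<in> {..length v}"
    then show "f (take k v) * g (drop k v) = f (take k v) * g' (drop k v)"
      using assms by (cases "k = 0") (auto simp: g')
  qed simp
  also have "\<dots> = (\<Sum>w | length w \<le> N. g w * smul f (smono w) v)"
    by (simp add: g'_def smul_sum_right sum_apply smul_ssc)
  finally show ?thesis .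
qed

text \<open>The Leibniz rule applied to the splitting of \<open>f\<close> by its first letter. As a
  recursion along words it determines the derivation, so later identities between operators reduce
  to comparing recursions.\<close>

lemma der_rec:
  assumes "b [] = 0" "a [] = 0"
  shows "der b a f = smul b (lder False f) + smul (ltr False) (der b a (lder False f))
                   + smul a (lder True f) + smul (ltr True) (der b a (lder True f))"
proof
  fix v :: word
  let ?N = "length v"
  have *: "(\<Sum>w | length w \<le> ?N. f (c # w) * der_word b a (c # w) v)
     = smul (gen b a c) (lder c f) v + smul (ltr c) (der b a (lder c f)) v" for c
  proof -
    have "(\<Sum>w | length w \<le> ?N. f (c # w) * der_word b a (c # w) v) =
      (\<Sum>w | length w \<le> ?N. lder c f w * smul (gen b a c) (smono w) v) + 
      (\<Sum>w | length w \<le> ?N. f (c # w) * smul (ltr c) (der_word b a w) v)"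
      by (simp add: der_word_Cons algebra_simps sum.distrib)
    also have "(\<Sum>w | length w \<le> ?N. lder c f w * smul (gen b a c) (smono w) v) = smul (gen b a c) (lder c f) v"
      using assms by (intro smul_expand[symmetric]) (auto simp: gen_def)
    also have "(\<Sum>w | length w \<le> ?N. f (c # w) * smul (ltr c) (der_word b a w) v)
       = smul (ltr c) (der b a (lder c f)) v"
    proof (cases v)
      case (Cons d v')
      have "der b a (lder c f) v' = (\<Sum>w | length w \<le> ?N. lder c f w * der_word b a w v')"
        using assms Cons by (intro der_apply_bound) auto
      then show ?thesis using Cons by auto
    qed (simp del: smul_Nil)
    finally show ?thesis .
  qed
  have "der b a f v = (\<Sum>w | length w \<le> Suc ?N. f w * der_word b a w v)"
    using assms by (intro der_apply_bound) auto
  also have "\<dots> = (smul b (lder False f) + smul (ltr False) (der b a (lder False f))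
                   + smul a (lder True f) + smul (ltr True) (der b a (lder True f))) v"
    by (simp add: sum_words_Suc_le * der_word_Nil) (simp add: gen_def)
  finally show "der b a f v = (smul b (lder False f) + smul (ltr False) (der b a (lder False f))
                   + smul a (lder True f) + smul (ltr True) (der b a (lder True f))) v" .
qed

lemma der_add: "der b a (f + g) = der b a f + der b a g"
  by (simp add: der_def fun_eq_iff sum.distrib algebra_simps)
lemma der_diff: "der b a (f - g) = der b a f - der b a g"
  by (simp add: der_def fun_eq_iff sum_subtractf algebra_simps)
lemma der_ssc: "der b a (ssc c f) = ssc c (der b a f)"
  by (simp add: der_def fun_eq_iff sum_distrib_left algebra_simps)
lemma der_zero [simp]: "der b a 0 = 0"
  by (simp add: der_def fun_eq_iff)
lemma der_sum: "der b a (\<Sum>i\<in>I. F i) = (\<Sum>i\<in>I. der b a (F i))" for F :: "'i \<Rightarrow> ser"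
proof
  fix v :: word
  have "der b a (\<Sum>i\<in>I. F i) v = (\<Sum>w | length w \<le> length v. \<Sum>i\<in>I. F i w * der_word b a w v)"
    by (simp add: der_def sum_apply sum_distrib_right)
  also have "\<dots> = (\<Sum>i\<in>I. der b a (F i)) v"
    by (subst sum.swap) (simp add: der_def sum_apply)
  finally show "der b a (\<Sum>i\<in>I. F i) v = (\<Sum>i\<in>I. der b a (F i)) v" .
qed

text \<open>Each coefficient of \<open>E f\<close> is a coefficient of \<open>E\<close> at a word
  shorter by one letter, and the empty word gives zero. Applied to a difference of two operators
  with the same first-letter recursion, this proves them equal.\<close>

lemma ltr_recursion_zero:
  assumes "\<And>f. E f = smul (ltr False) (E (lder False f)) + smul (ltr True) (E (lder True f))"
  shows "E f = (0 :: ser)"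
proof
  fix v show "E f v = 0 v"
  proof (induction v arbitrary: f)
    case Nil show ?case by (subst assms) (simp del: smul_Nil)
  next
    case (Cons c v) show ?case by (subst assms) (simp add: Cons)
  qed
qed

lemma gen_simps [simp]: "gen b a False = b" "gen b a True = a"
  by (simp_all add: gen_def)

lemma lder_zero [simp]: "lder c 0 = 0" by (simp add: fun_eq_iff)

lemma der_sone: "b [] = 0 \<Longrightarrow> a [] = 0 \<Longrightarrow> der b a sone = 0"
  by (subst der_rec) (simp_all add: lder_smono)

lemma der_ltr: "b [] = 0 \<Longrightarrow> a [] = 0 \<Longrightarrow> der b a (ltr c) = gen b a c"
  by (subst der_rec) (cases c; simp_all add: lder_smono der_sone)+

lemma der_smul:
  assumes ba: "b [] = 0" "a [] = 0"
  shows "der b a (smul f g) = smul (der b a f) g + smul f (der b a g)"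
proof -
  define E where "E f = der b a (smul f g) - smul (der b a f) g - smul f (der b a g)" for f
  have "E f = smul (ltr False) (E (lder False f)) + smul (ltr True) (E (lder True f))" for f
  proof -
    have 1: "der b a (smul f g) = ssc (f []) (der b a g)
      + smul b (smul (lder False f) g) + smul (ltr False) (der b a (smul (lder False f) g))
      + smul a (smul (lder True f) g) + smul (ltr True) (der b a (smul (lder True f) g))"
      by (subst der_rec[of b a, OF ba], subst der_rec[of b a g, OF ba])
         (simp add: lder_smul smul_simps der_add der_ssc)
    have 2: "smul (der b a f) g =
        smul b (smul (lder False f) g) + smul (ltr False) (smul (der b a (lder False f)) g)
      + smul a (smul (lder True f) g) + smul (ltr True) (smul (der b a (lder True f)) g)"
      by (subst der_rec[of b a, OF ba]) (simp add: smul_simps smul_assoc)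
    have 3: "smul f (der b a g) = ssc (f []) (der b a g)
      + smul (ltr False) (smul (lder False f) (der b a g)) + smul (ltr True) (smul (lder True f) (der b a g))"
      by (subst ser_decomp[of f]) (simp add: smul_simps smul_assoc)
    show ?thesis unfolding E_def 1 2 3 by (simp add: smul_simps)
  qed
  from ltr_recursion_zero[of E, OF this] show ?thesis by (simp add: E_def algebra_simps)
qed

text \<open>No continuity of \<open>T\<close> is assumed: splitting a series by its first letter is
  an exact finite identity, so linearity and the Leibniz rule alone force the recursion of
  \<open>der_rec\<close>.\<close>

lemma derivation_eq_der:
  assumes add: "\<And>f g. T (f + g) = T f + (T g :: ser)" and sc: "\<And>c f. T (ssc c f) = ssc c (T f)"
    and mul: "\<And>f g. T (smul f g) = smul (T f) g + smul f (T g)"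
    and nil: "T sX [] = 0" "T sY [] = 0"
  shows "T f = der (T sX) (T sY) f"
proof -
  define E where "E f = T f - der (T sX) (T sY) f" for f
  have one: "T sone = 0" using mul[of sone sone] by simp
  have "E f = smul (ltr False) (E (lder False f)) + smul (ltr True) (E (lder True f))" for f
  proof -
    have "T f = T (ssc (f []) sone + smul (ltr False) (lder False f) + smul (ltr True) (lder True f))"
      by (subst ser_decomp[of f]) simp
    also have "\<dots> = smul (T sX) (lder False f) + smul (ltr False) (T (lder False f))
       + smul (T sY) (lder True f) + smul (ltr True) (T (lder True f))"
      by (simp add: add sc mul one smul_simps sX_eq sY_eq)
    finally show ?thesis unfolding E_def
      by (subst der_rec[of "T sX" "T sY", OF nil]) (simp add: smul_simps)
  qed
  then have "E f = 0" by (rule ltr_recursion_zero)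
  then show ?thesis unfolding E_def by (simp only: right_minus_eq)
qed

lemma der_Nil [simp]: "b [] = 0 \<Longrightarrow> a [] = 0 \<Longrightarrow> der b a f [] = 0"
  by (subst der_rec) (simp_all add: smono_apply)

lemma der_commutator:
  assumes "b [] = 0" "a [] = 0" "b' [] = 0" "a' [] = 0"
  shows "der b a (der b' a' f) - der b' a' (der b a f) =
         der (der b a b' - der b' a' b) (der b a a' - der b' a' a) f"
proof -
  define T where "T f = der b a (der b' a' f) - der b' a' (der b a f)" for f
  have T: "T f = der (T sX) (T sY) f"
    by (rule derivation_eq_der[of T])
       (simp_all add: T_def der_add der_ssc smul_simps der_smul assms)
  have "T sX = der b a b' - der b' a' b" "T sY = der b a a' - der b' a' a"
    using assms by (simp_all add: T_def sX_eq sY_eq der_ltr)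
  with T have "T f = der (der b a b' - der b' a' b) (der b a a' - der b' a' a) f" by metis
  then show ?thesis by (simp only: T_def)
qed

lemma der_cong_le:
  assumes "\<And>u. length u \<le> length v \<Longrightarrow> b u = b' u" "\<And>u. length u \<le> length v \<Longrightarrow> a u = a' u"
    and "\<And>u. length u \<le> length v \<Longrightarrow> f u = f' u"
  shows "der b a f v = der b' a' f' v"
proof -
  have "der_word b a w v = der_word b' a' w v" for w
    unfolding der_word_def
    by (intro sum.cong refl smul_cong_le) (auto simp: gen_def assms)
  then show ?thesis unfolding der_def by (intro sum.cong) (auto simp: assms)
qed

lemma rder_simps: "rder c (f + g) = rder c f + rder c g" "rder c (f - g) = rder c f - rder c g"
  "rder c (ssc q f) = ssc q (rder c f)" "rder c (ltr d) = (if c = d then sone else 0)"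
  "rder c sone = 0"
  by (auto simp: fun_eq_iff smono_apply)

lemma ser_decomp_right: "f = ssc (f []) sone + smul (rder False f) (ltr False) + smul (rder True f) (ltr True)"
proof
  fix w show "f w = (ssc (f []) sone + smul (rder False f) (ltr False) + smul (rder True f) (ltr True)) w"
    by (cases w rule: rev_cases) (auto simp: smono_apply)
qed

text \<open>Splitting by the last letter gives
  \<open>D(f) = D(f_x) x + f_x b + D(f_y) y + f_y a\<close> up to the constant term; the products
  with \<open>b\<close> and \<open>a\<close> produce the chain-rule terms.\<close>

lemma rder_der:
  assumes ba: "b [] = 0" "a [] = 0"
  shows "rder c (der b a f) = der b a (rder c f) + smul (rder False f) (rder c b) + smul (rder True f) (rder c a)"
proof -
  have "der b a f = der b a (ssc (f []) sone + smul (rder False f) (ltr False) + smul (rder True f) (ltr True))"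
    by (subst ser_decomp_right[of f]) simp
  also have "\<dots> = smul (der b a (rder False f)) (ltr False) + smul (rder False f) b
      + smul (der b a (rder True f)) (ltr True) + smul (rder True f) a"
    using ba by (simp add: der_add der_ssc der_sone der_smul der_ltr smul_simps)
  finally show ?thesis
    using ba by (cases c) (simp_all add: rder_simps rder_smul smul_simps smono_apply)
qed

section \<open>Cyclic words\<close>

text \<open>Coefficient extraction on cyclic words: \<open>cyc f = 0\<close> says that \<open>f\<close> lies in the closure of the
  span of commutators.\<close>

definition cyc :: "ser \<Rightarrow> ser" where "cyc f = (\<lambda>w. \<Sum>i<length w. f (rotate i w))"

lemma cyc_simps: "cyc (f + g) = cyc f + cyc g" "cyc (f - g) = cyc f - cyc g" "cyc (ssc c f) = ssc c (cyc f)"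
  by (simp_all add: cyc_def fun_eq_iff sum.distrib sum_subtractf sum_distrib_left)

text \<open>Moving the window of rotations by one drops \<open>rotate k w\<close> and gains
  \<open>rotate (length w + k) w\<close>, which is the same word.\<close>

lemma sum_rotate_shift:
  fixes h :: "'a list \<Rightarrow> rat"
  shows "(\<Sum>i<length w. h (rotate (i + k) w)) = (\<Sum>i<length w. h (rotate i w))"
proof (induction k)
  case (Suc k)
  have "(\<Sum>i<length w. h (rotate (i + Suc k) w)) + h (rotate k w) = (\<Sum>i<Suc (length w). h (rotate (i + k) w))"
    by (simp add: sum.lessThan_Suc_shift del: sum.lessThan_Suc)
  also have "\<dots> = (\<Sum>i<length w. h (rotate (i + k) w)) + h (rotate (length w + k) w)"
    by simp
  also have "rotate (length w + k) w = rotate k w"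
    by (metis add.commute length_rotate rotate_id rotate_rotate mod_self)
  finally show ?case using Suc by simp
qed simp

lemma sum_rotate_reindex:
  fixes h :: "'a list \<Rightarrow> rat"
  shows "(\<Sum>i<length w. h (rotate k (rotate i w))) = (\<Sum>i<length w. h (rotate i w))"
  using sum_rotate_shift[of h k w] by (simp add: rotate_rotate add.commute)

text \<open>Rotating a word by the position of its cut exchanges the two factors, and the cut at
  \<open>k\<close> becomes the cut at \<open>length w - k\<close>.\<close>

lemma cyc_smul_commute: "cyc (smul f g) = cyc (smul g f)"
proof
  fix w
  have "cyc (smul f g) w = (\<Sum>k\<le>length w. \<Sum>i<length w. f (take k (rotate i w)) * g (drop k (rotate i w)))"
    unfolding cyc_def smul_def by (subst sum.swap) simp
  also have "\<dots> = (\<Sum>k\<le>length w. \<Sum>i<length w. g (take (length w - k) (rotate i w)) * f (drop (length w - k) (rotate i w)))"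
  proof (rule sum.cong)
    fix k assume "k \<in> {..length w}"
    then have k: "k \<le> length w" by simp
    have rot: "rotate k u = drop k u @ take k u" if "length u = length w" for u :: word
      using k that by (cases "k = length w") (auto simp: rotate_drop_take)
    have "(\<Sum>i<length w. f (take k (rotate i w)) * g (drop k (rotate i w)))
       = (\<Sum>i<length w. g (take (length w - k) (rotate k (rotate i w))) * f (drop (length w - k) (rotate k (rotate i w))))"
      using k by (intro sum.cong) (auto simp: rot)
    also have "\<dots> = (\<Sum>i<length w. g (take (length w - k) (rotate i w)) * f (drop (length w - k) (rotate i w)))"
      by (rule sum_rotate_reindex[where h="\<lambda>u. g (take (length w - k) u) * f (drop (length w - k) u)"])
    finally show "(\<Sum>i<length w. f (take k (rotate i w)) * g (drop k (rotate i w))) =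
      (\<Sum>i<length w. g (take (length w - k) (rotate i w)) * f (drop (length w - k) (rotate i w)))" .
  qed simp
  also have "\<dots> = (\<Sum>k\<le>length w. \<Sum>i<length w. g (take k (rotate i w)) * f (drop k (rotate i w)))"
    using sum.nat_diff_reindex[of "\<lambda>k. \<Sum>i<length w. g (take k (rotate i w)) * f (drop k (rotate i w))" "Suc (length w)"]
    by (simp add: lessThan_Suc_atMost del: sum.lessThan_Suc)
  also have "\<dots> = cyc (smul g f) w"
    unfolding cyc_def smul_def by (subst sum.swap) simp
  finally show "cyc (smul f g) w = cyc (smul g f) w" .
qed

lemma der_smono:
  assumes "b [] = 0" "a [] = 0"
  shows "der b a (smono w) = der_word b a w"
proof
  fix v
  have "der b a (smono w) v = (\<Sum>u | length u \<le> length v + length w. smono w u * der_word b a u v)"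
    using assms by (intro der_apply_bound) auto
  also have "\<dots> = der_word b a w v"
    by (simp add: smono_apply finite_words if_distrib[of "\<lambda>x. x * _"] cong: if_cong)
  finally show "der b a (smono w) v = der_word b a w v" .
qed

text \<open>Averaging over all rotations, with multiplicity \<open>n\<close>, moves the rotations
  from \<open>c\<close> onto \<open>f\<close>, where they assemble to \<open>cyc f\<close>.\<close>

lemma sum_rotate_invariant_zero:
  assumes f: "\<And>w. length w = n \<Longrightarrow> cyc f w = 0" and c: "\<And>k w. c (rotate k w) = c w" and n: "n > 0"
  shows "(\<Sum>w | length w = n. f w * c w) = 0"
proof -
  have bij: "bij_betw (rotate k) {w :: word. length w = n} {w. length w = n}" for k
  proof (rule bij_betw_byWitness[where f'="rotate (n - k mod n)"])
    have "rotate (n - k mod n + k) w = w" if "length w = n" for w :: word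
    proof -
      have "k mod n \<le> n" "k = k mod n + n * (k div n)" using n by (auto simp: less_imp_le)
      then have "n - k mod n + k = n + n * (k div n)" by linarith
      then show ?thesis using that by (simp add: rotate_id)
    qed
    then show "\<forall>w\<in>{w :: word. length w = n}. rotate (n - k mod n) (rotate k w) = w"
      "\<forall>w\<in>{w :: word. length w = n}. rotate k (rotate (n - k mod n) w) = w"
      by (auto simp: rotate_rotate add.commute)
  qed auto
  have "of_nat n * (\<Sum>w | length w = n. f w * c w) = (\<Sum>i<n. \<Sum>w | length w = n. f w * c w)"
    by simp
  also have "\<dots> = (\<Sum>i<n. \<Sum>w | length w = n. f (rotate i w) * c (rotate i w))"
    by (intro sum.cong refl sum.reindex_bij_betw[OF bij, symmetric])
  also have "\<dots> = (\<Sum>w | length w = n. cyc f w * c w)"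
    by (subst sum.swap) (simp add: c cyc_def sum_distrib_right)
  also have "\<dots> = 0" using f by (intro sum.neutral) auto
  finally show ?thesis using n by simp
qed

text \<open>A derivation descends to cyclic words: for fixed \<open>v\<close>, the number
  \<open>c w\<close> is a trace in \<open>w\<close> by the Leibniz rule, hence rotation invariant,
  and pairing it with \<open>f\<close> only sees \<open>cyc f\<close>.\<close>

lemma cyc_der_zero:
  assumes ba: "b [] = 0" "a [] = 0" and f: "cyc f = 0"
  shows "cyc (der b a f) = 0"
proof
  fix v
  define c where "c w = cyc (der b a (smono w)) v" for w
  have c_app: "c (u @ w) = c (w @ u)" for u w
    unfolding c_def smono_append[symmetric] der_smul[of b a, OF ba] cyc_simps
    by (simp add: cyc_smul_commute[of "der b a (smono u)"] cyc_smul_commute[of "smono u"])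
  have c_rot: "c (rotate k w) = c w" for k w
    using c_app[of "drop (k mod length w) w" "take (k mod length w) w"] by (simp add: rotate_drop_take)
  have "cyc (der b a f) v = (\<Sum>i<length v. \<Sum>w | length w \<le> length v. f w * der_word b a w (rotate i v))"
    by (simp add: cyc_def der_def)
  also have "\<dots> = (\<Sum>w | length w \<le> length v. f w * c w)"
    by (subst sum.swap) (simp add: c_def cyc_def der_smono ba sum_distrib_left)
  also have "\<dots> = (\<Sum>n\<le>length v. \<Sum>w | length w = n. f w * c w)"
  proof -
    have "{w :: word. length w \<le> length v} = (\<Union>n\<in>{..length v}. {w. length w = n})" by auto
    then show ?thesis by (simp only:) (subst sum.UNION_disjoint, auto simp: finite_words)
  qed
  also have "\<dots> = 0"
  proof (rule sum.neutral, rule ballI)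
    fix n show "(\<Sum>w | length w = n. f w * c w) = 0"
    proof (cases "n = 0")
      case True
      then show ?thesis by (simp add: c_def der_sone ba cyc_def)
    next
      case False
      then show ?thesis using c_rot f by (intro sum_rotate_invariant_zero) auto
    qed
  qed
  finally show "cyc (der b a f) v = 0 v" by simp
qed

text \<open>The chain-rule terms of \<open>rder_der\<close> are diagonal entries of products of the
  2 by 2 matrices of right derivatives of the two pairs. Together they form the trace of a
  commutator, which vanishes on cyclic words.\<close>

lemma cyc_divergence_cocycle:
  assumes "b [] = 0" "a [] = 0" "b' [] = 0" "a' [] = 0"
  shows "cyc (rder False (der b a b' - der b' a' b) + rder True (der b a a' - der b' a' a)) =
    cyc (der b a (rder False b' + rder True a')) - cyc (der b' a' (rder False b + rder True a))"
  using cyc_smul_commute[of "rder False b" "rder False b'"] cyc_smul_commute[of "rder True a" "rder True a'"]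
    cyc_smul_commute[of "rder False a" "rder True b'"] cyc_smul_commute[of "rder True b" "rder False a'"]
  by (simp add: rder_simps rder_der assms cyc_simps der_add)

lemmas pw = plus_fun_apply zero_fun_apply minus_apply uminus_apply ssc_apply

declare pw [simp del]

section \<open>Lie series\<close>

abbreviation dep :: "word \<Rightarrow> nat" where "dep w \<equiv> count_list w True"

lemma hom_apply: "hom n f w = (if length w = n then f w else 0)" by (simp add: hom_def)
lemma bihom_apply: "bihom n r f w = (if length w = n \<and> dep w = r then f w else 0)" by (simp add: bihom_def)

lemma sbr_ssc: "sbr (ssc c f) g = ssc c (sbr f g)" "sbr f (ssc c g) = ssc c (sbr f g)"
  by (simp_all add: sbr_eq smul_simps)
lemma sbr_add: "sbr (f + g) h = sbr f h + sbr g h" "sbr h (f + g) = sbr h f + sbr h g"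
  by (simp_all add: sbr_eq smul_simps)
lemma sbr_diff: "sbr (f - g) h = sbr f h - sbr g h" "sbr h (f - g) = sbr h f - sbr h g"
  by (simp_all add: sbr_eq smul_simps)
lemma sbr_zero [simp]: "sbr 0 h = 0" "sbr h 0 = 0"
  by (simp_all add: sbr_eq)

lemma der_sbr:
  assumes "b [] = 0" "a [] = 0"
  shows "der b a (sbr f g) = sbr (der b a f) g + sbr f (der b a g)"
  by (simp add: sbr_eq der_diff der_smul assms smul_simps)

lemma C_Suc_0: "C (Suc 0) = sY" by (simp add: C_def)
lemma C_Suc_Suc: "C (Suc (Suc i)) = sbr sX (C (Suc i))" by (simp add: C_def)

lemma lieCpoly_add: "f \<in> lieCpoly \<Longrightarrow> g \<in> lieCpoly \<Longrightarrow> f + g \<in> lieCpoly"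
  using lieCpoly.lc_add sadd_eq by metis
lemma lieCpoly_zero: "0 \<in> lieCpoly"
  using lieCpoly.lc_sc[OF lieCpoly.lc_C[of 1], of 0] by (simp add: ssc_simps)
lemma lieCpoly_diff: "f \<in> lieCpoly \<Longrightarrow> g \<in> lieCpoly \<Longrightarrow> f - g \<in> lieCpoly"
proof -
  assume "f \<in> lieCpoly" "g \<in> lieCpoly"
  then have "f + ssc (-1) g \<in> lieCpoly" by (intro lieCpoly_add lieCpoly.lc_sc)
  moreover have "f + ssc (-1) g = f - g" by (simp add: fun_eq_iff pw)
  ultimately show ?thesis by metis
qed
lemma lieCpoly_sum: "(\<And>i. i \<in> I \<Longrightarrow> F i \<in> lieCpoly) \<Longrightarrow> (\<Sum>i\<in>I. F i) \<in> lieCpoly"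
proof (cases "finite I")
  case True
  assume "\<And>i. i \<in> I \<Longrightarrow> F i \<in> lieCpoly"
  with True show ?thesis
    by (induction I rule: finite_induct) (simp_all only: sum.empty sum.insert lieCpoly_zero lieCpoly_add insert_iff simp_thms)
next
  case False
  then show ?thesis by (simp only: sum.infinite lieCpoly_zero simp_thms)
qed

text \<open>ad x is a derivation of brackets and shifts \<open>C i\<close> to the next one. As y is
  itself the first of the \<open>C i\<close>, the subalgebra is stable under both letters, so it is
  an ideal.\<close>

lemma sbr_sX_lieCpoly: "f \<in> lieCpoly \<Longrightarrow> sbr sX f \<in> lieCpoly"
proof (induction rule: lieCpoly.induct)
  case (lc_C i)
  then show ?case using C_Suc_Suc[of "i - 1"] lieCpoly.lc_C[of "Suc i"] by simp
next
  case (lc_br f g)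
  have "sbr sX (sbr f g) = sbr (sbr sX f) g + sbr f (sbr sX g)"
    by (simp add: sbr_eq smul_simps smul_assoc)
  then show ?case using lc_br by (auto intro: lieCpoly_add lieCpoly.lc_br)
qed (auto simp: sadd_eq sbr_add sbr_ssc intro: lieCpoly_add lieCpoly.lc_sc)

lemma sbr_ltr_lieCpoly: "f \<in> lieCpoly \<Longrightarrow> sbr (ltr c) f \<in> lieCpoly"
  using sbr_sX_lieCpoly[of f] lieCpoly.lc_br[OF lieCpoly.lc_C[of 1], of f]
  by (cases c) (simp_all add: sX_eq sY_eq C_Suc_0)

lemma lieCpoly_subset_liepoly: "f \<in> lieCpoly \<Longrightarrow> f \<in> liepoly"
proof (induction rule: lieCpoly.induct)
  case (lc_C i)
  have "C (Suc j) \<in> liepoly" for j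
    by (induction j) (auto simp: C_Suc_0 C_Suc_Suc intro: liepoly.intros)
  then show ?case using lc_C by (cases i) auto
qed (auto intro: liepoly.intros)

lemma lieC_subset_lie2: "f \<in> lieC \<Longrightarrow> f \<in> lie2"
  by (simp add: lieC_def lie2_def lieCpoly_subset_liepoly)

text \<open>Every \<open>C i\<close> contains a y, so no bracket of them reaches a power of x. From
  this follow the absence of constant terms and of linear terms in x, and the normalization that
  makes partners unique.\<close>

lemma lieCpoly_depth0: "f \<in> lieCpoly \<Longrightarrow> dep w = 0 \<Longrightarrow> f w = 0"
proof (induction arbitrary: w rule: lieCpoly.induct)
  case (lc_C i)
  have "dep w = 0 \<Longrightarrow> C (Suc j) w = 0" for j w
  proof (induction j arbitrary: w)
    case 0 then show ?case by (auto simp: C_Suc_0 sY_eq smono_apply)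
  next
    case (Suc j)
    have "C (Suc j) (take k w) = 0" "C (Suc j) (drop k w) = 0" for k
      using Suc.prems by (auto intro!: Suc.IH simp: count_list_0_iff dest: in_set_takeD in_set_dropD)
    then show ?case by (simp add: C_Suc_Suc sbr_eq smul_def pw)
  qed
  then show ?case using lc_C by (cases i) auto
next
  case (lc_br f g)
  have "f (take k w) = 0" "f (drop k w) = 0" for k
    using lc_br.prems by (auto intro!: lc_br.IH simp: count_list_0_iff dest: in_set_takeD in_set_dropD)
  then show ?case by (simp add: sbr_eq smul_def pw)
qed (auto simp: sadd_eq pw)

lemma lieC_depth0: "f \<in> lieC \<Longrightarrow> dep w = 0 \<Longrightarrow> f w = 0"
  using lieCpoly_depth0[of "hom (length w) f" w] by (simp add: lieC_def hom_apply)

lemma lieC_Nil: "f \<in> lieC \<Longrightarrow> f [] = 0" by (rule lieC_depth0) auto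

section \<open>Bigrading by weight and depth\<close>

definition bideg :: "nat \<Rightarrow> nat \<Rightarrow> ser \<Rightarrow> bool" where
  "bideg n r f \<longleftrightarrow> (\<forall>w. f w \<noteq> 0 \<longrightarrow> length w = n \<and> dep w = r)"

lemma bideg_smul: assumes "bideg n r f" "bideg m s g" shows "bideg (n + m) (r + s) (smul f g)"
  unfolding bideg_def
proof (intro allI impI)
  fix w assume "smul f g w \<noteq> 0"
  then obtain k where "k \<le> length w" "f (take k w) * g (drop k w) \<noteq> 0"
    unfolding smul_def by (meson atMost_iff sum.not_neutral_contains_not_neutral)
  then have "length (take k w) = n" "dep (take k w) = r" "length (drop k w) = m" "dep (drop k w) = s"
    using assms unfolding bideg_def by auto
  then show "length w = n + m \<and> dep w = r + s"
    by (metis append_take_drop_id count_list_append length_append)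
qed

lemma bideg_diff: "bideg n r f \<Longrightarrow> bideg n r g \<Longrightarrow> bideg n r (f - g)"
  unfolding bideg_def by (metis diff_zero fun_diff_def)

lemma bideg_ltr: "bideg 1 (if c then 1 else 0) (ltr c)"
  by (auto simp: bideg_def smono_apply)

lemma bideg_sbr: assumes "bideg n r f" "bideg m s g" shows "bideg (n + m) (r + s) (sbr f g)"
  using bideg_smul[OF assms] bideg_smul[OF assms(2,1)] by (simp add: sbr_eq bideg_diff add.commute)

lemma bideg_C: "1 \<le> i \<Longrightarrow> bideg i 1 (C i)"
proof -
  have "bideg (Suc j) 1 (C (Suc j))" for j
  proof (induction j)
    case 0 show ?case using bideg_ltr[of True] by (simp add: C_Suc_0 sY_eq)
  next
    case (Suc j) 
    then show ?case using bideg_sbr[OF bideg_ltr[of False] Suc] by (simp add: C_Suc_Suc sX_eq)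
  qed
  then show "1 \<le> i \<Longrightarrow> bideg i 1 (C i)" by (cases i) auto
qed

lemma bihom_bideg: "bideg n r f \<Longrightarrow> bihom m s f = (if m = n \<and> s = r then f else 0)"
  by (auto simp: bideg_def bihom_apply fun_eq_iff pw)

lemma bideg_bihom: "bideg n r (bihom n r f)"
  by (auto simp: bideg_def bihom_apply)

lemma bihom_smul:
  "bihom n r (smul f g) = (\<Sum>i\<le>n. \<Sum>s\<le>r. smul (bihom i s f) (bihom (n - i) (r - s) g))"
proof
  fix w
  have "(\<Sum>i\<le>n. \<Sum>s\<le>r. smul (bihom i s f) (bihom (n - i) (r - s) g)) w =
     (\<Sum>(i, s)\<in>{..n} \<times> {..r}. \<Sum>k\<le>length w. bihom i s f (take k w) * bihom (n - i) (r - s) g (drop k w))"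
    by (simp add: sum_apply sum.cartesian_product) (simp add: smul_def case_prod_beta)
  also have "\<dots> = (\<Sum>k\<le>length w. \<Sum>(i, s)\<in>{..n} \<times> {..r}. bihom i s f (take k w) * bihom (n - i) (r - s) g (drop k w))"
    unfolding case_prod_beta by (rule sum.swap)
  also have "\<dots> = (\<Sum>k\<le>length w. if length w = n \<and> dep w = r then f (take k w) * g (drop k w) else 0)"
  proof (rule sum.cong[OF refl])
    fix k assume "k \<in> {..length w}"
    then have k: "k \<le> length w" by simp
    have d: "dep w = dep (take k w) + dep (drop k w)" by (metis append_take_drop_id count_list_append)
    \<comment> \<open>For a fixed cut only one bidegree \<open>(i, s)\<close> can contribute, namely
      that of the prefix.\<close>
    have "(\<Sum>(i, s)\<in>{..n} \<times> {..r}. bihom i s f (take k w) * bihom (n - i) (r - s) g (drop k w))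
      = (\<Sum>p\<in>{..n} \<times> {..r}. if p = (k, dep (take k w)) then
           (if length w = n \<and> dep w = r then f (take k w) * g (drop k w) else 0) else 0)"
    proof (rule sum.cong[OF refl])
      fix p assume "p \<in> {..n} \<times> {..r}"
      then obtain i s where p: "p = (i, s)" and i_s: "i \<le> n" "s \<le> r" by auto
      have L: "length (take k w) = k" "length (drop k w) = length w - k" using k by auto
      have "bihom i s f (take k w) * bihom (n - i) (r - s) g (drop k w) = (if (i, s) = (k, dep (take k w)) then
           (if length w = n \<and> dep w = r then f (take k w) * g (drop k w) else 0) else 0)"
      proof (cases "i = k \<and> s = dep (take k w)")
        case True
        have "length w - k = n - i \<longleftrightarrow> length w = n" "dep (drop k w) = r - s \<longleftrightarrow> dep w = r"
          using True i_s k unfolding d by auto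
        then show ?thesis using True L unfolding bihom_apply by simp
      next
        case False
        then show ?thesis using L by (cases "i = k") (simp_all add: bihom_apply)
      qed
      then show "(case p of (i, s) \<Rightarrow> bihom i s f (take k w) * bihom (n - i) (r - s) g (drop k w)) =
         (if p = (k, dep (take k w)) then
           (if length w = n \<and> dep w = r then f (take k w) * g (drop k w) else 0) else 0)" by (simp only: p prod.case)
    qed
    also have "\<dots> = (if length w = n \<and> dep w = r then f (take k w) * g (drop k w) else 0)"
      using k d by (auto simp: sum.delta)
    finally show "(\<Sum>(i, s)\<in>{..n} \<times> {..r}. bihom i s f (take k w) * bihom (n - i) (r - s) g (drop k w))
      = (if length w = n \<and> dep w = r then f (take k w) * g (drop k w) else 0)" .
  qed
  also have "\<dots> = bihom n r (smul f g) w"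
    by (auto simp: bihom_apply smul_def)
  finally show "bihom n r (smul f g) w = (\<Sum>i\<le>n. \<Sum>s\<le>r. smul (bihom i s f) (bihom (n - i) (r - s) g)) w" by simp
qed

lemma bihom_simps: "bihom n r (f + g) = bihom n r f + bihom n r g" "bihom n r (f - g) = bihom n r f - bihom n r g"
  "bihom n r (ssc c f) = ssc c (bihom n r f)" "bihom n r 0 = 0"
  by (auto simp: fun_eq_iff pw bihom_apply)

lemma bihom_sbr:
  "bihom n r (sbr f g) = (\<Sum>i\<le>n. \<Sum>s\<le>r. sbr (bihom i s f) (bihom (n - i) (r - s) g))"
proof -
  have flip: "(\<Sum>i\<le>n. F i) = (\<Sum>i\<le>n. F (n - i))" for F :: "nat \<Rightarrow> ser" and n
    using sum.nat_diff_reindex[of F "Suc n"] by (simp add: lessThan_Suc_atMost del: sum.lessThan_Suc)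
  have "bihom n r (smul g f) = (\<Sum>i\<le>n. \<Sum>s\<le>r. smul (bihom (n - i) (r - s) g) (bihom i s f))"
    unfolding bihom_smul
    by (subst flip, subst flip[of _ r]) (intro sum.cong refl, simp)
  then show ?thesis by (simp only: sbr_eq bihom_simps bihom_smul sum_subtractf)
qed

lemma bihom_lieCpoly: "f \<in> lieCpoly \<Longrightarrow> bihom n r f \<in> lieCpoly"
proof (induction arbitrary: n r rule: lieCpoly.induct)
  case (lc_C i)
  then show ?case by (simp add: bihom_bideg[OF bideg_C] lieCpoly_zero lieCpoly.lc_C)
next
  case (lc_br f g)
  then show ?case unfolding bihom_sbr by (intro lieCpoly_sum lieCpoly.lc_br) 
qed (auto simp: sadd_eq bihom_simps intro: lieCpoly_add lieCpoly.lc_sc)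

lemma hom_eq_sum_bihom: "hom n f = (\<Sum>r\<le>n. bihom n r f)"
proof
  fix w
  have "dep w \<le> length w" by (simp add: count_le_length)
  then show "hom n f w = (\<Sum>r\<le>n. bihom n r f) w"
    by (auto simp: hom_apply sum_apply bihom_apply sum.delta)
qed

lemma hom_lieCpoly: "f \<in> lieCpoly \<Longrightarrow> hom n f \<in> lieCpoly"
  unfolding hom_eq_sum_bihom by (intro lieCpoly_sum bihom_lieCpoly)

lemma lieC_iff_bihom: "f \<in> lieC \<longleftrightarrow> (\<forall>n r. bihom n r f \<in> lieCpoly)"
proof
  assume f: "f \<in> lieC"
  have "bihom n r f = bihom n r (hom n f)" for n r by (auto simp: fun_eq_iff pw bihom_apply hom_apply)
  with f show "\<forall>n r. bihom n r f \<in> lieCpoly" by (simp add: lieC_def bihom_lieCpoly)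
next
  assume "\<forall>n r. bihom n r f \<in> lieCpoly"
  then show "f \<in> lieC" unfolding lieC_def hom_eq_sum_bihom by (auto intro: lieCpoly_sum)
qed

lemma lieCpoly_subset_lieC: "f \<in> lieCpoly \<Longrightarrow> f \<in> lieC"
  by (simp add: lieC_def hom_lieCpoly)

lemma lieC_bihom: "f \<in> lieC \<Longrightarrow> bihom n r f \<in> lieC"
  using lieC_iff_bihom lieCpoly_subset_lieC by blast

lemma lieC_add: "f \<in> lieC \<Longrightarrow> g \<in> lieC \<Longrightarrow> f + g \<in> lieC"
  by (simp add: lieC_iff_bihom bihom_simps lieCpoly_add)
lemma lieC_diff: "f \<in> lieC \<Longrightarrow> g \<in> lieC \<Longrightarrow> f - g \<in> lieC"
  by (simp add: lieC_iff_bihom bihom_simps lieCpoly_diff)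
lemma lieC_ssc: "f \<in> lieC \<Longrightarrow> ssc c f \<in> lieC"
  by (simp add: lieC_iff_bihom bihom_simps lieCpoly.lc_sc)
lemma lieC_zero: "0 \<in> lieC"
  by (simp add: lieCpoly_subset_lieC lieCpoly_zero)

lemma der_lieCpoly:
  assumes "b \<in> lieCpoly" "a \<in> lieCpoly" "f \<in> lieCpoly"
  shows "der b a f \<in> lieCpoly"
proof -
  have nil: "b [] = 0" "a [] = 0" using assms by (auto intro: lieCpoly_depth0)
  from assms(3) show ?thesis
  proof (induction rule: lieCpoly.induct)
    case (lc_C i)
    have "der b a (C (Suc j)) \<in> lieCpoly" for j
    proof (induction j)
      case 0 show ?case using nil assms by (simp add: C_Suc_0 sY_eq der_ltr)
    next
      case (Suc j)
      have "der b a (C (Suc (Suc j))) = sbr b (C (Suc j)) + sbr sX (der b a (C (Suc j)))"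
        using nil by (simp add: C_Suc_Suc der_sbr sX_eq der_ltr)
      then show ?case using Suc assms
        by (simp add: lieCpoly_add lieCpoly.lc_br lieCpoly.lc_C sbr_sX_lieCpoly)
    qed
    then show ?case using lc_C by (cases i) auto
  qed (auto simp: sadd_eq der_add der_ssc der_sbr nil intro: lieCpoly_add lieCpoly.lc_sc lieCpoly.lc_br)
qed

lemma der_lieC:
  assumes "b \<in> lieC" "a \<in> lieC" "f \<in> lieC"
  shows "der b a f \<in> lieC"
  unfolding lieC_def
proof (intro CollectI allI)
  fix n
  \<comment> \<open>Derivations never lower the weight, so weight \<open>n\<close> of the result
    depends on the three series only up to weight \<open>n\<close>. Truncating there reduces the
    claim to Lie polynomials.\<close>
  define tr where "tr f = (\<Sum>k\<le>n. hom k f)" for f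
  have tr: "tr f w = f w" if "length w \<le> n" for f w
    using that by (simp add: tr_def sum_apply hom_apply)
  have tr_lie: "tr f \<in> lieCpoly" if "f \<in> lieC" for f
    unfolding tr_def using that by (intro lieCpoly_sum) (auto simp: lieC_def)
  have "hom n (der b a f) = hom n (der (tr b) (tr a) (tr f))"
    by (rule ext) (auto simp: hom_apply tr intro!: der_cong_le)
  then show "hom n (der b a f) \<in> lieCpoly"
    using assms by (simp add: hom_lieCpoly der_lieCpoly tr_lie)
qed

section \<open>A Dynkin operator counting the depth\<close>

text \<open>Right-normed bracketing of the letters, with the innermost letter sent through x to 0
  and y to y; the classical Dynkin operator keeps both. A nonzero value is an iterated ad of letters
  on y, hence lies in the ideal spanned by brackets of the \<open>C i\<close>.\<close>

primrec dyn :: "word \<Rightarrow> ser" where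
  "dyn [] = 0"
| "dyn (c # w) = sbr (ltr c) (dyn w) + (if w = [] \<and> c then sY else 0)"

definition dynkin :: "ser \<Rightarrow> ser" where
  "dynkin f = (\<lambda>v. \<Sum>w | length w = length v. f w * dyn w v)"

definition dpt :: "ser \<Rightarrow> ser" where "dpt f = (\<lambda>w. of_nat (dep w) * f w)"

lemma dyn_lieCpoly: "dyn w \<in> lieCpoly"
proof (induction w)
  case (Cons c w)
  have "sY \<in> lieCpoly" using lieCpoly.lc_C[of 1] by (simp add: C_Suc_0)
  then show ?case using Cons by (auto intro: lieCpoly_add lieCpoly_zero sbr_ltr_lieCpoly simp del: plus_fun_apply)
qed (simp add: lieCpoly_zero)

lemma bideg_dyn: "bideg (length w) (dep w) (dyn w)"
proof (induction w)
  case (Cons c w)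
  show ?case
  proof (cases "w = []")
    case True
    then show ?thesis using bideg_ltr[of True] by (auto simp: sY_eq bideg_def pw)
  next
    case False
    then show ?thesis using bideg_sbr[OF bideg_ltr[of c] Cons] by (auto simp: bideg_def)
  qed
qed (simp add: bideg_def pw)

lemma dyn_snoc_False: "dyn (w @ [False]) = 0"
  by (induction w) simp_all

lemma sbr_ltr_apply_cong:
  assumes "\<And>u. Suc (length u) = length v \<Longrightarrow> f u = g u"
  shows "sbr (ltr c) f v = sbr (ltr c) g v"
proof -
  have "smul (ltr c) f v = smul (ltr c) g v" using assms by (cases v) (auto simp del: smul_Nil)
  moreover have "smul f (ltr c) v = smul g (ltr c) v" using assms by (cases v rule: rev_cases) (auto simp del: smul_Nil)
  ultimately show ?thesis by (simp add: sbr_eq pw)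
qed

lemma dynkin_simps: "dynkin (f + g) = dynkin f + dynkin g" "dynkin (f - g) = dynkin f - dynkin g"
  "dynkin (ssc c f) = ssc c (dynkin f)"
  by (simp_all add: dynkin_def fun_eq_iff pw sum.distrib sum_subtractf sum_distrib_left algebra_simps)

lemma sbr_sum_right: "sbr h (\<Sum>i\<in>I. F i) = (\<Sum>i\<in>I. sbr h (F i))" for F :: "'i \<Rightarrow> ser"
  by (simp only: sbr_eq smul_sum_left smul_sum_right sum_subtractf)

lemma dynkin_ltr: "dynkin (ltr c) = (if c then sY else 0)"
proof
  fix v
  have "dynkin (ltr c) v = (\<Sum>w | length w = length v. if w = [c] then dyn [c] v else 0)"
    unfolding dynkin_def by (intro sum.cong) (auto simp: smono_apply)
  also have "\<dots> = (if c then sY else 0) v"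
    using finite_words(1)[of "length v"] by (auto simp: sum.delta sY_eq smono_apply pw)
  finally show "dynkin (ltr c) v = (if c then sY else 0) v" .
qed

lemma dynkin_ltr_smul:
  "dynkin (smul (ltr c) g) = sbr (ltr c) (dynkin g) + ssc (g []) (dynkin (ltr c))"
proof
  fix v
  show "dynkin (smul (ltr c) g) v = (sbr (ltr c) (dynkin g) + ssc (g []) (dynkin (ltr c))) v"
  proof (cases "length v")
    case 0
    then show ?thesis by (simp add: dynkin_def sbr_eq smono_apply pw)
  next
    case (Suc n)
    have "dynkin (smul (ltr c) g) v = (\<Sum>w | length w = n. g w * dyn (c # w) v)"
      unfolding dynkin_def Suc sum_words_Suc_eq by (cases c) simp_all
    also have "\<dots> = (\<Sum>w | length w = n. g w * sbr (ltr c) (dyn w) v) +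
       (\<Sum>w | length w = n. g w * (if w = [] \<and> c then sY v else 0))"
      by (subst sum.distrib[symmetric], intro sum.cong) (auto simp: pw algebra_simps)
    also have "(\<Sum>w | length w = n. g w * sbr (ltr c) (dyn w) v) = sbr (ltr c) (\<Sum>w | length w = n. ssc (g w) (dyn w)) v"
      by (simp add: sbr_sum_right sum_apply sbr_ssc pw)
    also have "\<dots> = sbr (ltr c) (dynkin g) v"
      using Suc by (intro sbr_ltr_apply_cong) (simp add: dynkin_def sum_apply pw)
    also have "(\<Sum>w | length w = n. g w * (if w = [] \<and> c then sY v else 0)) = 
      (\<Sum>w | length (w :: word) = n. if w = [] then g [] * (if c then sY v else 0) else 0)"
      by (intro sum.cong) auto
    also have "\<dots> = ssc (g []) (dynkin (ltr c)) v"
      using finite_words(1)[of n] Suc by (auto simp: sum.delta dynkin_ltr sY_eq smono_apply pw)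
    finally show ?thesis by (simp add: pw)
  qed
qed

lemma liepoly_Nil: "f \<in> liepoly \<Longrightarrow> f [] = 0"
  by (induction rule: liepoly.induct) (auto simp: sX_eq sY_eq smono_apply sadd_eq sbr_eq pw)

text \<open>By definition a letter in front acts through ad, and ad is a representation by the
  Jacobi identity, so every Lie polynomial in front acts the same way. The term with
  \<open>g []\<close> records that the innermost letter is treated separately.\<close>

lemma dynkin_liepoly_smul:
  "f \<in> liepoly \<Longrightarrow> dynkin (smul f g) = sbr f (dynkin g) + ssc (g []) (dynkin f)"
proof (induction arbitrary: g rule: liepoly.induct)
  case lp_X then show ?case by (simp only: sX_eq dynkin_ltr_smul)
next
  case lp_Y then show ?case by (simp only: sY_eq dynkin_ltr_smul)
next
  case (lp_add f h) then show ?case by (simp add: sadd_eq smul_simps dynkin_simps sbr_add)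
next
  case (lp_sc f c) then show ?case
    by (simp add: smul_simps dynkin_simps sbr_ssc mult.commute)
next
  case (lp_br f h)
  have "dynkin (smul (sbr f h) g) = dynkin (smul f (smul h g)) - dynkin (smul h (smul f g))"
    by (simp add: sbr_eq smul_simps smul_assoc dynkin_simps)
  also have "\<dots> = sbr (sbr f h) (dynkin g) + ssc (g []) (sbr f (dynkin h) - sbr h (dynkin f))"
    using lp_br.hyps by (simp add: lp_br.IH liepoly_Nil ssc_simps) (simp add: sbr_eq smul_simps smul_assoc)
  also have "sbr f (dynkin h) - sbr h (dynkin f) = dynkin (sbr f h)"
    using lp_br.hyps by (simp add: sbr_eq[of f h] dynkin_simps lp_br.IH liepoly_Nil ssc_simps)
  finally show ?case .
qed

lemma dpt_smul: "dpt (smul f g) = smul (dpt f) g + smul f (dpt g)"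
proof
  fix w
  have "dpt (smul f g) w = (\<Sum>k\<le>length w. of_nat (dep (take k w) + dep (drop k w)) * (f (take k w) * g (drop k w)))"
    unfolding count_list_append[symmetric] by (simp add: dpt_def smul_def sum_distrib_left)
  also have "\<dots> = (smul (dpt f) g + smul f (dpt g)) w"
    by (simp add: smul_def dpt_def sum.distrib algebra_simps pw)
  finally show "dpt (smul f g) w = (smul (dpt f) g + smul f (dpt g)) w" .
qed

lemma dpt_simps: "dpt (f + g) = dpt f + dpt g" "dpt (f - g) = dpt f - dpt g" "dpt (ssc c f) = ssc c (dpt f)"
  by (simp_all add: dpt_def fun_eq_iff pw algebra_simps)

text \<open>The Dynkin--Specht--Wever theorem, with the depth in place of the degree.\<close>

lemma dynkin_liepoly: "f \<in> liepoly \<Longrightarrow> dynkin f = dpt f"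
proof (induction rule: liepoly.induct)
  case lp_X show ?case unfolding sX_eq dynkin_ltr by (auto simp: dpt_def smono_apply fun_eq_iff pw)
next
  case lp_Y show ?case unfolding sY_eq dynkin_ltr by (auto simp: dpt_def smono_apply fun_eq_iff sY_eq pw)
next
  case (lp_br f g)
  have "dynkin (sbr f g) = sbr f (dpt g) - sbr g (dpt f)"
    using lp_br by (simp add: sbr_eq[of f g] dynkin_simps dynkin_liepoly_smul liepoly_Nil ssc_simps)
  also have "\<dots> = dpt (sbr f g)" by (simp add: sbr_eq dpt_simps dpt_smul)
  finally show ?case .
qed (simp_all add: sadd_eq dynkin_simps dpt_simps)

lemma dynkin_lie2: "f \<in> lie2 \<Longrightarrow> dynkin f = dpt f"
proof
  fix v assume "f \<in> lie2"
  then have "dynkin (hom (length v) f) v = dpt (hom (length v) f) v"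
    by (simp add: lie2_def dynkin_liepoly)
  then show "dynkin f v = dpt f v" by (simp add: dynkin_def dpt_def hom_apply)
qed

text \<open>Words ending in x are annihilated, so only the half \<open>x f\<close> of the commutator
  survives, and there the leading x acts as ad x. This is what the modified treatment of the
  innermost letter achieves.\<close>

lemma dynkin_sbr_sX: "f [] = 0 \<Longrightarrow> dynkin (sbr sX f) = sbr sX (dynkin f)"
proof -
  assume f: "f [] = 0"
  have "dynkin (smul f sX) v = 0" for v
    unfolding dynkin_def
  proof (rule sum.neutral, rule ballI)
    fix w show "smul f sX w * dyn w v = 0"
      by (cases w rule: rev_cases) (auto simp: sX_eq dyn_snoc_False pw smono_apply)
  qed
  then have "dynkin (smul f sX) = 0" by (simp add: fun_eq_iff pw)
  then show ?thesis using f dynkin_ltr_smul[of False f] by (simp add: sbr_eq[of sX f] dynkin_simps ssc_simps) (simp add: sX_eq)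
qed

section \<open>Push-invariance on words and the partner\<close>

definition wpush :: "ser \<Rightarrow> bool" where
  "wpush b \<longleftrightarrow> (\<forall>k v. b (replicate k False @ True # v) = b (v @ True # replicate k False))"

lemma word_cases:
  obtains k where "w = replicate k False" | k v where "w = replicate k False @ True # v"
proof -
  have "(\<exists>k. w = replicate k False) \<or> (\<exists>k v. w = replicate k False @ True # v)"
  proof (induction w)
    case Nil show ?case by (auto intro: exI[of _ 0])
  next
    case (Cons c w)
    show ?case
    proof (cases c)
      case True
      then have "c # w = replicate 0 False @ True # w" by simp
      then show ?thesis by blast
    next
      case False
      then have "\<And>k. c # replicate k False = replicate (Suc k) False"
        "\<And>k v. c # replicate k False @ True # v = replicate (Suc k) False @ True # v" by simp_all
      then show ?thesis using Cons by metis
    qed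
  qed
  then show ?thesis using that by blast
qed

text \<open>Comparing coefficients in \<open>[x,a] = [y,b]\<close> gives \<open>a(yw) = -b(wx)\<close> and \<open>a(xw) = a(wx)\<close>, hence
  \<open>a(x^k y u) = -b(u x^(k+1))\<close>.\<close>

primrec push_sol :: "ser \<Rightarrow> nat \<Rightarrow> word \<Rightarrow> rat" where
  "push_sol b k [] = 0"
| "push_sol b k (c # w) = (if c then - b (w @ replicate (Suc k) False) else push_sol b (Suc k) w)"

lemma push_sol_replicate: "push_sol b k (replicate i False) = 0"
  by (induction i arbitrary: k) auto

lemma push_sol_replicate_True:
  "push_sol b k (replicate i False @ True # u) = - b (u @ replicate (Suc (k + i)) False)"
  by (induction i arbitrary: k) auto

lemma sbr_ltr_Nil [simp]: "sbr (ltr c) f [] = 0"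
  by (simp add: sbr_eq pw smono_apply)

lemma sbr_ltr_single [simp]: "sbr (ltr c) f [d] = 0"
  using smul_ltr_snoc[of f c "[]" d] by (simp add: sbr_eq pw)

lemma sbr_ltr_Cons_snoc: "sbr (ltr c) f (d # w @ [e]) = (if c = d then f (w @ [e]) else 0) - (if c = e then f (d # w) else 0)"
  using smul_ltr_snoc[of f c "d # w" e] by (simp add: sbr_eq pw)

lemma word_ends_cases:
  obtains "w = []" | c where "w = [c]" | c v d where "w = c # v @ [d]"
  by (cases w; cases "tl w" rule: rev_cases) auto

text \<open>Compare coefficients by outer letters. The cases xx and yx hold by construction of
  \<open>push_sol\<close>; the case xy is push-invariance for a positive leading exponent, or the
  vanishing of \<open>b\<close> on powers of x, and the case yy is push-invariance for leading
  exponent 0.\<close>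

lemma sbr_sX_push_sol:
  assumes "wpush b" and b0: "\<And>k. b (replicate k False) = 0"
  shows "sbr sX (push_sol b 0) = sbr sY b"
proof
  have push: "b (replicate k False @ True # v) = b (v @ True # replicate k False)" for k v
    using assms by (simp add: wpush_def)
  fix w show "sbr sX (push_sol b 0) w = sbr sY b w"
  proof (cases w rule: word_ends_cases)
    case (3 c v d)
    have xx: "push_sol b 0 (v @ [False]) = push_sol b 0 (False # v)"
    proof (cases v rule: word_cases)
      case (1 k)
      then show ?thesis
        using push_sol_replicate[of b 0 "Suc k"] by (simp add: replicate_append_same)
    next
      case (2 k u)
      then show ?thesis using push_sol_replicate_True[of b 0 k "u @ [False]"] push_sol_replicate_True[of b 0 "Suc k" u]
        by simp
    qed
    have xy: "push_sol b 0 (v @ [True]) = - b (False # v)"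
    proof (cases v rule: word_cases)
      case (1 k)
      then show ?thesis using push_sol_replicate_True[of b 0 k "[]"] by simp
    next
      case (2 k u)
      then show ?thesis
        using push_sol_replicate_True[of b 0 k "u @ [True]"] push[of "Suc k" u] by simp
    qed
    have yx: "push_sol b 0 (True # v) = - b (v @ [False])" by simp
    have yy: "b (True # v) = b (v @ [True])" using push[of 0 v] by simp
    show ?thesis using xx xy yx yy 3 by (cases c; cases d) (simp_all add: sX_eq sY_eq sbr_ltr_Cons_snoc)
  qed (simp_all add: sX_eq sY_eq)
qed

lemma dpt_sbr: "dpt (sbr f g) = sbr (dpt f) g + sbr f (dpt g)"
  by (simp add: sbr_eq dpt_simps dpt_smul smul_simps)

lemma lie2_sbr_sY: "b \<in> lie2 \<Longrightarrow> sbr sY b \<in> lie2"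
  unfolding lie2_def
proof (intro CollectI allI)
  fix n assume "b \<in> {f. \<forall>n. hom n f \<in> liepoly}"
  then have b: "hom n b \<in> liepoly" for n by auto
  show "hom n (sbr sY b) \<in> liepoly"
  proof (cases n)
    case 0
    then have "hom n (sbr sY b) = ssc 0 sY" by (auto simp: fun_eq_iff hom_apply sY_eq pw)
    then show ?thesis by (metis liepoly.lp_sc liepoly.lp_Y)
  next
    case (Suc m)
    have "hom n (sbr sY b) = sbr sY (hom m b)"
    proof
      fix w show "hom n (sbr sY b) w = sbr sY (hom m b) w"
        using Suc by (cases w rule: word_ends_cases) (auto simp: hom_apply sY_eq sbr_ltr_Cons_snoc)
    qed
    then show ?thesis using b by (simp add: liepoly.lp_br liepoly.lp_Y)
  qed
qed

lemma wpush_imp_partner: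
  assumes b: "b \<in> lieC" and push: "wpush b"
  shows "\<exists>a\<in>lieC. sbr sX a = sbr sY b"
proof -
  define s where "s = push_sol b 0"
  \<comment> \<open>The Dynkin operator multiplies Lie series by the depth, so the depth is divided
    out. At depth 0 the quotient is 0, which agrees with \<open>dynkin s\<close> having no such
    part.\<close>
  define a where "a = (\<lambda>v. dynkin s v / of_nat (dep v))"
  have sb: "sbr sX s = sbr sY b"
    unfolding s_def using b by (intro sbr_sX_push_sol push lieC_depth0) auto
  have a_lie: "a \<in> lieC"
    unfolding lieC_def
  proof (intro CollectI allI)
    fix n
    have "hom n a = (\<Sum>w | length w = n. ssc (s w / of_nat (dep w)) (dyn w))"
    proof
      fix v
      have "dyn w v / of_nat (dep v) = dyn w v / of_nat (dep w)" "length v \<noteq> length w \<Longrightarrow> dyn w v = 0" for w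
        using bideg_dyn[of w] unfolding bideg_def by force+
      then show "hom n a v = (\<Sum>w | length w = n. ssc (s w / of_nat (dep w)) (dyn w)) v"
        by (auto simp: hom_apply a_def dynkin_def sum_apply pw sum_divide_distrib intro!: sum.cong
             intro: sum.neutral[symmetric])
    qed
    then show "hom n a \<in> lieCpoly" by (simp add: lieCpoly_sum lieCpoly.lc_sc dyn_lieCpoly)
  qed
  have dyn0: "dep v = 0 \<Longrightarrow> dynkin s v = 0" for v
    unfolding dynkin_def by (intro sum.neutral) (auto simp: lieCpoly_depth0[OF dyn_lieCpoly])
  have da: "dpt a = dynkin s"
    by (rule ext) (auto simp: dpt_def a_def dyn0)
  have dX: "dpt sX = 0" by (auto simp: dpt_def sX_eq smono_apply fun_eq_iff pw)
  have "dpt (sbr sX a) = sbr sX (dynkin s)" by (simp add: dpt_sbr dX da)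
  also have "\<dots> = dynkin (sbr sX s)" by (simp add: dynkin_sbr_sX s_def)
  also have "\<dots> = dpt (sbr sY b)" using b by (simp add: sb dynkin_lie2 lie2_sbr_sY lieC_subset_lie2)
  finally have d: "dpt (sbr sX a) = dpt (sbr sY b)" .
  \<comment> \<open>\<open>dpt\<close> forgets the words without y, which are treated apart; both
    brackets vanish on them.\<close>
  have "sbr sX a v = sbr sY b v" for v
  proof (cases "dep v = 0")
    case False
    then show ?thesis using fun_cong[OF d, of v] by (simp add: dpt_def)
  next
    case True
    show ?thesis
    proof (cases v rule: word_ends_cases)
      case (3 c u e)
      have "a u' = 0" if "dep u' = 0" for u' using a_lie that by (rule lieC_depth0)
      then show ?thesis using True 3 by (auto simp: sX_eq sY_eq sbr_ltr_Cons_snoc split: if_splits)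
    qed (simp_all add: sX_eq sY_eq)
  qed
  then show ?thesis using a_lie by blast
qed

lemma partner_relations:
  assumes "sbr sX a = sbr sY b"
  shows "a (w @ [False]) = a (False # w)" "a (w @ [True]) = - b (False # w)"
    "a (True # w) = - b (w @ [False])" "b (w @ [True]) = b (True # w)"
  using fun_cong[OF assms, of "False # w @ [False]"] fun_cong[OF assms, of "False # w @ [True]"]
    fun_cong[OF assms, of "True # w @ [False]"] fun_cong[OF assms, of "True # w @ [True]"]
  by (simp_all add: sX_eq sY_eq sbr_ltr_Cons_snoc)

lemma shift_replicate:
  assumes "\<And>w. a (w @ [False]) = (a (False # w) :: rat)"
  shows "a (u @ replicate k False) = a (replicate k False @ u)"
proof (induction k arbitrary: u)
  case (Suc k)
  have "a (u @ replicate (Suc k) False) = a ((u @ replicate k False) @ [False])"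
    by (simp add: replicate_append_same)
  also have "\<dots> = a ((False # u) @ replicate k False)" unfolding assms by simp
  also have "\<dots> = a (replicate k False @ False # u)" by (rule Suc)
  finally show ?case by (simp add: replicate_app_Cons_same)
qed simp

text \<open>The relations turn a coefficient of \<open>b\<close> into one of \<open>a\<close>, where
  powers of x may be carried from one end to the other, and then back into one of \<open>b\<close>.
  The two y at the ends in between account for the exchanged positions.\<close>

lemma partner_imp_wpush:
  assumes "sbr sX a = sbr sY b"
  shows "wpush b"
  unfolding wpush_def
proof (intro allI)
  fix k v
  note rel = partner_relations[OF assms]
  show "b (replicate k False @ True # v) = b (v @ True # replicate k False)"
  proof (cases k)
    case 0 then show ?thesis using rel(4)[of v] by simp
  next
    case (Suc j)
    have "b (v @ True # replicate k False) = b ((v @ True # replicate j False) @ [False])"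
      using Suc by (simp add: replicate_append_same)
    also have "\<dots> = - a ((True # v @ [True]) @ replicate j False)" using rel(3)[of "v @ True # replicate j False"] by simp
    also have "\<dots> = - a (replicate j False @ True # v @ [True])"
      by (subst shift_replicate[of a, OF rel(1)]) simp
    also have "\<dots> = b (False # replicate j False @ True # v)"
      using rel(2)[of "replicate j False @ True # v"] by simp
    finally show ?thesis using Suc by simp
  qed
qed

text \<open>Only series in x commute with x: the difference satisfies the partner relations with
  \<open>b = 0\<close>, so its x's can be carried behind the first y, where the coefficient is
  0.\<close>

lemma sbr_sX_inj:
  assumes eq: "sbr sX a = sbr sX a'" and 0: "\<And>k. a (replicate k False) = a' (replicate k False)"
  shows "a = a'"
proof
  define d where "d = a - a'"
  have "sbr sX d = sbr sY 0" using eq by (simp add: d_def sbr_diff)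
  note rel = partner_relations[OF this]
  fix w show "a w = a' w"
  proof (cases w rule: word_cases)
    case (1 k) then show ?thesis using 0 by simp
  next
    case (2 k v)
    have "d (replicate k False @ True # v) = d ((True # v) @ replicate k False)"
      by (subst shift_replicate[of d, OF rel(1)]) simp
    also have "\<dots> = 0" using rel(3)[of "v @ replicate k False"] by (simp add: pw)
    finally show ?thesis using 2 by (simp add: d_def pw)
  qed
qed

lemma lieC_partner_unique: "a \<in> lieC \<Longrightarrow> a' \<in> lieC \<Longrightarrow> sbr sX a = sbr sX a' \<Longrightarrow> a = a'"
  by (rule sbr_sX_inj) (auto simp: lieC_depth0)

text \<open>\<open>D([x,y]) = [b,y] + [x,a]\<close>, while the conditions on linear terms hold
  automatically at depth 0.\<close>

lemma is_oder2_der_iff: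
  assumes "b \<in> lieC" "a \<in> lieC"
  shows "is_oder2 (der b a) \<longleftrightarrow> sbr sX a = sbr sY b"
proof -
  have nil: "b [] = 0" "a [] = 0" using assms by (auto simp: lieC_Nil)
  have "der b a (sbr sX sY) = sbr b sY + sbr sX a"
    using nil by (simp add: der_sbr sX_eq sY_eq der_ltr)
  also have "\<dots> = sbr sX a - sbr sY b" by (simp add: sbr_eq)
  finally have *: "der b a (sbr sX sY) = szero \<longleftrightarrow> sbr sX a = sbr sY b"
    by (simp add: szero_eq)
  show ?thesis
  proof
    assume "is_oder2 (der b a)"
    then show "sbr sX a = sbr sY b" unfolding is_oder2_def using * by blast
  next
    assume "sbr sX a = sbr sY b"
    moreover have "b [False] = 0" "a [False] = 0" using assms by (auto intro: lieC_depth0)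
    ultimately show "is_oder2 (der b a)"
      unfolding is_oder2_def using * assms lieC_subset_lie2 by blast
  qed
qed

lemma ex1_partner:
  assumes "b \<in> lieC" "wpush b"
  shows "\<exists>!a. a \<in> lieC \<and> is_oder2 (der b a)"
  using wpush_imp_partner[OF assms] is_oder2_der_iff[OF assms(1)] lieC_partner_unique by metis

lemma partner_props:
  assumes "b \<in> lieC" "wpush b"
  shows "partner b \<in> lieC" "is_oder2 (der b (partner b))" "sbr sX (partner b) = sbr sY b"
  using theI'[OF ex1_partner[OF assms]] is_oder2_der_iff[OF assms(1)] by (auto simp: partner_def)

lemma partner_eqI:
  assumes "b \<in> lieC" "a \<in> lieC" "sbr sX a = sbr sY b"
  shows "partner b = a"
  using partner_props[OF assms(1) partner_imp_wpush[OF assms(3)]] assms lieC_partner_unique by metis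

section \<open>Generating functions of word coefficients\<close>

definition wds :: "nat \<Rightarrow> nat \<Rightarrow> word set" where "wds n r = {w. length w = n \<and> dep w = r}"

primrec wev :: "word \<Rightarrow> rat list \<Rightarrow> rat" where
  "wev [] zs = 1"
| "wev (c # w) zs = (if c then wev w (tl zs) else hd zs * wev w zs)"

definition gf :: "ser \<Rightarrow> nat \<Rightarrow> nat \<Rightarrow> rat list \<Rightarrow> rat" where
  "gf f n r zs = (\<Sum>w\<in>wds n r. f w * wev w zs)"

lemma finite_wds [simp]: "finite (wds n r)"
  by (rule finite_subset[OF _ finite_words(1)[of n]]) (auto simp: wds_def)

lemma wds_0: "wds 0 r = (if r = 0 then {[]} else {})"
  by (auto simp: wds_def)

lemma wds_Suc: "wds (Suc n) r = (#) False ` wds n r \<union> (if r = 0 then {} else (#) True ` wds n (r - 1))"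
proof -
  have "w \<in> wds (Suc n) r \<longleftrightarrow> w \<in> (#) False ` wds n r \<union> (if r = 0 then {} else (#) True ` wds n (r - 1))" for w
    by (cases w; cases "hd w"; cases r) (auto simp: wds_def)
  then show ?thesis by blast
qed

lemma wds_Suc_right: "wds (Suc n) r = (\<lambda>w. w @ [False]) ` wds n r \<union> (if r = 0 then {} else (\<lambda>w. w @ [True]) ` wds n (r - 1))"
proof -
  have "w \<in> wds (Suc n) r \<longleftrightarrow> w \<in> (\<lambda>w. w @ [False]) ` wds n r \<union> (if r = 0 then {} else (\<lambda>w. w @ [True]) ` wds n (r - 1))" for w
    by (cases w rule: rev_cases; cases "last w"; cases r) (auto simp: wds_def)
  then show ?thesis by blast
qed

lemma gf_0: "gf f 0 r zs = (if r = 0 then f [] else 0)"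
  by (simp add: gf_def wds_0)

lemma gf_rec:
  "gf f (Suc n) r zs = hd zs * gf (lder False f) n r zs + (if r = 0 then 0 else gf (lder True f) n (r - 1) (tl zs))"
  unfolding gf_def wds_Suc
  by (subst sum.union_disjoint) (auto simp: sum.reindex sum_distrib_left algebra_simps)

lemma gf_simps: "gf (f + g) n r zs = gf f n r zs + gf g n r zs" "gf (f - g) n r zs = gf f n r zs - gf g n r zs"
  "gf (ssc c f) n r zs = c * gf f n r zs" "gf 0 n r zs = 0"
  by (simp_all add: gf_def pw sum.distrib sum_subtractf algebra_simps sum_distrib_left)

lemma gf_sum: "gf (\<Sum>i\<in>I. F i) n r zs = (\<Sum>i\<in>I. gf (F i) n r zs)"
proof (cases "finite I")
  case True
  then show ?thesis by (induction I rule: finite_induct) (simp_all add: gf_simps)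
qed (simp add: gf_simps)

lemma wev_append: "wev (u @ w) zs = wev u zs * wev w (drop (dep u) zs)"
  by (induction u arbitrary: zs) (auto simp: drop_Suc)

lemma wev_append_list: "dep w < length zs \<Longrightarrow> wev w (zs @ ys) = wev w zs"
proof (induction w arbitrary: zs)
  case (Cons c w)
  show ?case
  proof (cases zs)
    case zs: (Cons z zs')
    then show ?thesis using Cons.IH[of zs'] Cons.IH[of zs] Cons.prems by (cases c) auto
  qed (use Cons.prems in simp)
qed simp

lemma wev_replicate: "wev (replicate k False) zs = hd zs ^ k"
  by (induction k) auto

lemma gf_rec_right:
  assumes "length zs = Suc r"
  shows "gf f (Suc n) r zs = last zs * gf (rder False f) n r zs + (if r = 0 then 0 else gf (rder True f) n (r - 1) (butlast zs))"
proof -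
  have F: "wev (w @ [False]) zs = last zs * wev w zs" if "w \<in> wds n r" for w
    using that assms by (simp add: wds_def wev_append hd_drop_conv_nth last_conv_nth) 
      (metis diff_Suc_1 last_conv_nth list.size(3) nat.simps(3))
  have T: "wev (w @ [True]) zs = wev w (butlast zs)" if "w \<in> wds n (r - 1)" "r \<noteq> 0" for w
  proof -
    have "zs \<noteq> []" using assms by auto
    then have "wev w zs = wev w (butlast zs @ [last zs])" by simp
    also have "\<dots> = wev w (butlast zs)" using that assms by (intro wev_append_list) (auto simp: wds_def)
    finally show ?thesis by (simp add: wev_append)
  qed
  have inj: "inj_on (\<lambda>w. w @ [c]) A" for c :: bool and A by (auto simp: inj_on_def)
  show ?thesis unfolding gf_def wds_Suc_right
    by (subst sum.union_disjoint) (auto simp: sum.reindex[OF inj] sum_distrib_left algebra_simps F T)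
qed

lemma gf_ltr_False: "gf (smul (ltr False) f) (Suc n) r zs = hd zs * gf f n r zs"
proof -
  have "lder False (smul (ltr False) f) = f" "lder True (smul (ltr False) f) = 0"
    by (auto simp: fun_eq_iff pw)
  then show ?thesis by (simp add: gf_rec gf_simps)
qed

lemma gf_ltr_True: "gf (smul (ltr True) f) (Suc n) (Suc r) zs = gf f n r (tl zs)"
proof -
  have "lder False (smul (ltr True) f) = 0" "lder True (smul (ltr True) f) = f"
    by (auto simp: fun_eq_iff pw)
  then show ?thesis by (simp add: gf_rec gf_simps)
qed

fun diffs :: "rat list \<Rightarrow> rat list" where
  "diffs (x # y # zs) = (x - y) # diffs (y # zs)"
| "diffs _ = []"

lemma length_diffs [simp]: "length (diffs zs) = length zs - 1"
  by (induction zs rule: diffs.induct) auto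

lemma diffs_Cons: "zs \<noteq> [] \<Longrightarrow> diffs (x # zs) = (x - hd zs) # diffs zs"
  by (cases zs) auto

lemma diffs_snoc: "zs \<noteq> [] \<Longrightarrow> diffs (zs @ [x]) = diffs zs @ [last zs - x]"
  by (induction zs rule: diffs.induct) auto

lemma sum_list_diffs: "zs \<noteq> [] \<Longrightarrow> sum_list (diffs zs) = hd zs - last zs"
  by (induction zs rule: diffs.induct) auto

lemma diffs_surj: "\<exists>zs. length zs = Suc (length us) \<and> diffs zs = us"
proof (induction us)
  case Nil show ?case by (auto intro: exI[of _ "[0]"])
next
  case (Cons u us)
  then obtain zs where "length zs = Suc (length us)" "diffs zs = us" by blast
  moreover from this have "zs \<noteq> []" by auto
  ultimately have "length ((u + hd zs) # zs) = Suc (length (u # us)) \<and> diffs ((u + hd zs) # zs) = u # us"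
    by (simp add: diffs_Cons)
  then show ?case by blast
qed

text \<open>An x in front multiplies by the first variable, an x behind the y of \<open>C\<close> by
  the next one; each ad x therefore contributes the factor \<open>z - hd zs\<close>.\<close>

lemma gf_C_smul:
  "zs \<noteq> [] \<Longrightarrow> gf (smul (C (Suc j)) f) (Suc j + n) (Suc r) (z # zs) = (z - hd zs) ^ j * gf f n r zs"
proof (induction j arbitrary: f n)
  case 0 then show ?case by (simp add: C_Suc_0 sY_eq gf_ltr_True)
next
  case (Suc j)
  have "smul (C (Suc (Suc j))) f = smul (ltr False) (smul (C (Suc j)) f) - smul (C (Suc j)) (smul (ltr False) f)"
    by (simp add: C_Suc_Suc sbr_eq smul_simps smul_assoc sX_eq)
  then have "gf (smul (C (Suc (Suc j))) f) (Suc (Suc j) + n) (Suc r) (z # zs) =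
      z * gf (smul (C (Suc j)) f) (Suc j + n) (Suc r) (z # zs)
      - gf (smul (C (Suc j)) (smul (ltr False) f)) (Suc j + Suc n) (Suc r) (z # zs)"
    by (simp add: gf_simps gf_ltr_False)
  also have "\<dots> = (z - hd zs) ^ Suc j * gf f n r zs"
    using Suc.prems by (subst (1 2) Suc.IH) (simp_all add: gf_ltr_False algebra_simps)
  finally show ?case .
qed

lemma Cmon_simps: "Cmon [] = sone" "Cmon (i # a) = smul (C i) (Cmon a)"
  by (simp_all add: Cmon_def)

definition mexp :: "nat list \<Rightarrow> rat list \<Rightarrow> rat" where
  "mexp a us = (\<Prod>i<length a. us ! i ^ (a ! i - 1))"

lemma mexp_Nil [simp]: "mexp [] us = 1" by (simp add: mexp_def)
lemma mexp_Cons: "mexp (i # a) (u # us) = u ^ (i - 1) * mexp a us"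
  by (simp add: mexp_def prod.lessThan_Suc_shift del: prod.lessThan_Suc)

lemma gf_Cmon:
  "\<forall>i\<in>set a. 1 \<le> i \<Longrightarrow> length zs = Suc (length a) \<Longrightarrow>
   gf (Cmon a) (sum_list a) (length a) zs = mexp a (diffs zs)"
proof (induction a arbitrary: zs)
  case Nil then show ?case by (simp add: Cmon_simps gf_0 smono_apply)
next
  case (Cons i a)
  then obtain z zs' where zs: "zs = z # zs'" "length zs' = Suc (length a)" by (cases zs) auto
  then have "zs' \<noteq> []" by auto
  moreover obtain j where "i = Suc j" using Cons.prems by (cases i) auto
  ultimately show ?case using Cons zs gf_C_smul[of zs' j "Cmon a" "sum_list a" "length a" z]
    by (simp add: Cmon_simps diffs_Cons mexp_Cons)
qed

lemma bideg_Cmon: "\<forall>i\<in>set a. 1 \<le> i \<Longrightarrow> bideg (sum_list a) (length a) (Cmon a)"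
proof (induction a)
  case Nil show ?case by (auto simp: bideg_def Cmon_simps smono_apply)
next
  case (Cons i a)
  then show ?case using bideg_smul[OF bideg_C[of i], of "sum_list a" "length a" "Cmon a"] by (simp add: Cmon_simps)
qed

subsection \<open>Polynomial functions on lines\<close>

text \<open>Restriction to lines replaces polynomials in several variables by polynomials in one,
  for which vanishing at almost all points suffices.\<close>

definition polyfun :: "(rat \<Rightarrow> rat) \<Rightarrow> bool" where "polyfun f \<longleftrightarrow> (\<exists>p. \<forall>t. f t = poly p t)"

lemma polyfun_intros:
  "polyfun (\<lambda>t. c)" "polyfun (\<lambda>t. t)"
  "polyfun f \<Longrightarrow> polyfun g \<Longrightarrow> polyfun (\<lambda>t. f t + g t)"
  "polyfun f \<Longrightarrow> polyfun g \<Longrightarrow> polyfun (\<lambda>t. f t * g t)"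
proof -
  show "polyfun (\<lambda>t. c)" unfolding polyfun_def by (rule exI[of _ "[:c:]"]) simp
  show "polyfun (\<lambda>t. t)" unfolding polyfun_def by (rule exI[of _ "[:0, 1:]"]) simp
  assume "polyfun f" "polyfun g"
  then obtain p q where "\<forall>t. f t = poly p t" "\<forall>t. g t = poly q t" unfolding polyfun_def by blast
  then have "\<forall>t. f t + g t = poly (p + q) t" "\<forall>t. f t * g t = poly (p * q) t" by simp_all
  then show "polyfun (\<lambda>t. f t + g t)" "polyfun (\<lambda>t. f t * g t)" unfolding polyfun_def by blast+
qed

lemma polyfun_sum: "(\<And>i. i \<in> I \<Longrightarrow> polyfun (F i)) \<Longrightarrow> polyfun (\<lambda>t. \<Sum>i\<in>I. F i t)"
  by (induction I rule: infinite_finite_induct) (auto intro: polyfun_intros)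

lemma polyfun_zero:
  assumes "polyfun f" "finite {t. f t \<noteq> 0}"
  shows "f t = 0"
proof -
  obtain p where p: "\<And>t. f t = poly p t" using assms(1) unfolding polyfun_def by blast
  have "p = 0"
  proof (rule ccontr)
    assume "p \<noteq> 0"
    then have "finite {t. poly p t = 0}" by (rule poly_roots_finite)
    then have "finite ({t. f t \<noteq> 0} \<union> {t. poly p t = 0})" using assms(2) by simp
    moreover have "{t. f t \<noteq> 0} \<union> {t. poly p t = 0} = UNIV" using p by auto
    ultimately show False using infinite_UNIV_char_0[where 'a=rat] by simp
  qed
  then show ?thesis using p by simp
qed

lemma polyfun_wev: "(\<And>g. g \<in> set gs \<Longrightarrow> polyfun g) \<Longrightarrow> polyfun (\<lambda>t. wev w (map (\<lambda>g. g t) gs))"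
proof (induction w arbitrary: gs)
  case (Cons c w)
  have "polyfun (\<lambda>t. hd (map (\<lambda>g. g t) gs))"
    using Cons.prems by (cases gs) (auto intro: polyfun_intros)
  moreover have "polyfun (\<lambda>t. wev w (map (\<lambda>g. g t) (tl gs)))"
    using Cons.prems by (intro Cons.IH) (metis list.sel(2) list.set_sel(2))
  ultimately show ?case using Cons by (cases c) (auto simp: map_tl intro: polyfun_intros)
qed (auto intro: polyfun_intros)

lemma polyfun_gf: "(\<And>g. g \<in> set gs \<Longrightarrow> polyfun g) \<Longrightarrow> polyfun (\<lambda>t. gf f n r (map (\<lambda>g. g t) gs))"
  unfolding gf_def by (intro polyfun_sum polyfun_intros polyfun_wev) auto

lemma gf_generic_zero:
  assumes gen: "\<And>zs. length zs = m \<Longrightarrow> distinct zs \<Longrightarrow> 0 \<notin> set zs \<Longrightarrow> gf f n r zs = 0"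
    and zs: "length zs = m"
  shows "gf f n r zs = 0"
proof -
  \<comment> \<open>The direction \<open>(1, ..., m)\<close> has distinct nonzero entries, so each
    forbidden coincidence \<open>z_i = z_j\<close> or \<open>z_i = 0\<close> excludes a single
    parameter; \<open>?B\<close> collects these.\<close>
  define gs where "gs = map (\<lambda>i t. zs ! i + t * of_nat (Suc i)) [0..<m]"
  let ?Z = "\<lambda>t. map (\<lambda>g. g t) gs"
  have Z: "?Z t = map (\<lambda>i. zs ! i + t * of_nat (Suc i)) [0..<m]" for t
    by (simp add: gs_def)
  have "polyfun (\<lambda>t. gf f n r (?Z t))"
    by (rule polyfun_gf) (auto simp: gs_def intro!: polyfun_intros)
  moreover have "finite {t. gf f n r (?Z t) \<noteq> 0}"
  proof (rule finite_subset)
    let ?B = "(\<Union>i\<in>{..<m}. \<Union>j\<in>{..<m}. {(zs ! j - zs ! i) / (of_nat i - of_nat j)}) \<union> (\<Union>i\<in>{..<m}. {- zs ! i / of_nat (Suc i)})"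
    show "finite ?B" by auto
    show "{t. gf f n r (?Z t) \<noteq> 0} \<subseteq> ?B"
    proof
      fix t assume "t \<in> {t. gf f n r (?Z t) \<noteq> 0}"
      then have "\<not> (distinct (?Z t) \<and> 0 \<notin> set (?Z t))"
        using gen[of "?Z t"] by (auto simp: Z)
      then consider i j where "i < m" "j < m" "i \<noteq> j" "zs ! i + t * of_nat (Suc i) = zs ! j + t * of_nat (Suc j)"
        | i where "i < m" "zs ! i + t * of_nat (Suc i) = 0"
        unfolding Z by (auto simp: distinct_map inj_on_def)
      then show "t \<in> ?B"
      proof cases
        case 1
        then have "t * (of_nat i - of_nat j) = zs ! j - zs ! i" by (simp add: algebra_simps)
        moreover have "(of_nat i :: rat) - of_nat j \<noteq> 0" using 1 by simp
        ultimately have "t = (zs ! j - zs ! i) / (of_nat i - of_nat j)" by (simp add: field_simps)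
        then show ?thesis using 1 by blast
      next
        case 2
        then have "t = - zs ! i / of_nat (Suc i)" by (simp add: field_simps del: of_nat_Suc)
        then show ?thesis using 2 by blast
      qed
    qed
  qed
  ultimately have "gf f n r (?Z 0) = 0" by (rule polyfun_zero)
  moreover have "?Z 0 = zs" using zs map_nth[of zs] by (simp add: Z)
  ultimately show ?thesis by metis
qed

text \<open>Putting the first variable equal to 0 isolates the words beginning with y. What remains
  is the first variable times the part beginning with x, and dividing by it is possible at generic
  points.\<close>

lemma gf_zero_imp_zero:
  assumes "\<And>zs. length zs = Suc r \<Longrightarrow> gf f n r zs = 0" "w \<in> wds n r"
  shows "f w = 0"
  using assms
proof (induction n arbitrary: f r w)
  case 0
  then show ?case using 0(1)[of "replicate (Suc r) 0"] by (auto simp: wds_0 gf_0 split: if_splits)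
next
  case (Suc n)
  have T: "gf (lder True f) n (r - 1) zs = 0" if "length zs = r" "r \<noteq> 0" for zs
    using Suc.prems(1)[of "0 # zs"] that by (simp add: gf_rec)
  have F: "gf (lder False f) n r zs = 0" if "length zs = Suc r" for zs
  proof (rule gf_generic_zero[OF _ that])
    fix zs :: "rat list" assume zs: "length zs = Suc r" "distinct zs" "0 \<notin> set zs"
    then have "hd zs \<noteq> 0" by (cases zs) auto
    moreover have "r \<noteq> 0 \<Longrightarrow> gf (lder True f) n (r - 1) (tl zs) = 0" using zs by (intro T) auto
    ultimately show "gf (lder False f) n r zs = 0" using Suc.prems(1)[OF zs(1)] by (auto simp: gf_rec split: if_splits)
  qed
  from Suc.prems(2) consider u where "w = False # u" "u \<in> wds n r" | u where "w = True # u" "u \<in> wds n (r - 1)" "r \<noteq> 0"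
    unfolding wds_Suc by (auto split: if_splits)
  then show ?case
  proof cases
    case 1
    have "lder False f u = 0" by (rule Suc.IH[where f="lder False f" and r=r, OF F 1(2)])
    then show ?thesis using 1 by simp
  next
    case 2
    have "lder True f u = 0"
    proof (rule Suc.IH[where f="lder True f" and r="r - 1", OF _ 2(2)])
      fix zs :: "rat list" assume "length zs = Suc (r - 1)"
      with 2 show "gf (lder True f) n (r - 1) zs = 0" by (intro T) auto
    qed
    then show ?thesis using 2 by simp
  qed
qed

subsection \<open>Expansion in the \<open>C\<^sub>i\<close>\<close>

lemma finite_comps [simp]: "finite (comps n r)"
proof (rule finite_subset)
  show "comps n r \<subseteq> {a. set a \<subseteq> {..n} \<and> length a = r}"
    by (auto simp: comps_def dest: member_le_sum_list)
qed (simp add: finite_lists_length_eq)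

definition Cspan :: "nat \<Rightarrow> nat \<Rightarrow> ser set" where
  "Cspan n r = {f. \<exists>k. f = (\<Sum>a\<in>comps n r. ssc (k a) (Cmon a))}"

lemma Cspan_zero: "0 \<in> Cspan n r"
  unfolding Cspan_def by (intro CollectI exI[of _ "\<lambda>_. 0"]) (simp add: ssc_simps)

lemma Cspan_add: "f \<in> Cspan n r \<Longrightarrow> g \<in> Cspan n r \<Longrightarrow> f + g \<in> Cspan n r"
proof -
  assume "f \<in> Cspan n r" "g \<in> Cspan n r"
  then obtain k l where "f = (\<Sum>a\<in>comps n r. ssc (k a) (Cmon a))" "g = (\<Sum>a\<in>comps n r. ssc (l a) (Cmon a))"
    unfolding Cspan_def by blast
  then have "f + g = (\<Sum>a\<in>comps n r. ssc (k a + l a) (Cmon a))"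
    by (auto simp: fun_eq_iff pw sum_apply sum.distrib algebra_simps)
  then show ?thesis unfolding Cspan_def by (intro CollectI exI)
qed

lemma Cspan_ssc: "f \<in> Cspan n r \<Longrightarrow> ssc c f \<in> Cspan n r"
proof -
  assume "f \<in> Cspan n r"
  then obtain k where "f = (\<Sum>a\<in>comps n r. ssc (k a) (Cmon a))"
    unfolding Cspan_def by blast
  then have "ssc c f = (\<Sum>a\<in>comps n r. ssc (c * k a) (Cmon a))"
    by (auto simp: fun_eq_iff pw sum_apply sum_distrib_left algebra_simps)
  then show ?thesis unfolding Cspan_def by (intro CollectI exI)
qed

lemma Cspan_diff: "f \<in> Cspan n r \<Longrightarrow> g \<in> Cspan n r \<Longrightarrow> f - g \<in> Cspan n r"
proof -
  have "f - g = f + ssc (-1) g" by (simp add: fun_eq_iff pw)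
  then show "f \<in> Cspan n r \<Longrightarrow> g \<in> Cspan n r \<Longrightarrow> f - g \<in> Cspan n r"
    using Cspan_add Cspan_ssc by metis
qed

lemma Cspan_sum: "(\<And>i. i \<in> I \<Longrightarrow> F i \<in> Cspan n r) \<Longrightarrow> (\<Sum>i\<in>I. F i) \<in> Cspan n r"
  by (induction I rule: infinite_finite_induct) (auto intro: Cspan_zero Cspan_add)

lemma Cspan_Cmon: "a \<in> comps n r \<Longrightarrow> Cmon a \<in> Cspan n r"
  unfolding Cspan_def
proof (intro CollectI exI[of _ "\<lambda>a'. if a' = a then 1 else 0"])
  assume a: "a \<in> comps n r"
  have "(\<Sum>a'\<in>comps n r. ssc (if a' = a then 1 else 0) (Cmon a')) = (\<Sum>a'\<in>comps n r. if a' = a then Cmon a else 0)"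
    by (intro sum.cong) (auto simp: ssc_simps)
  then show "Cmon a = (\<Sum>a'\<in>comps n r. ssc (if a' = a then 1 else 0) (Cmon a'))" using a by simp
qed

lemma Cmon_append: "Cmon (a @ a') = smul (Cmon a) (Cmon a')"
  by (induction a) (simp_all add: Cmon_simps smul_assoc)

lemma Cspan_smul:
  assumes "f \<in> Cspan n r" "g \<in> Cspan m s"
  shows "smul f g \<in> Cspan (n + m) (r + s)"
proof -
  obtain k l where "f = (\<Sum>a\<in>comps n r. ssc (k a) (Cmon a))" "g = (\<Sum>a\<in>comps m s. ssc (l a) (Cmon a))"
    using assms unfolding Cspan_def by blast
  then have "smul f g = (\<Sum>a\<in>comps n r. \<Sum>a'\<in>comps m s. smul (ssc (k a) (Cmon a)) (ssc (l a') (Cmon a')))"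
    by (simp only: smul_sum_left smul_sum_right[of "ssc _ _"])
  moreover have "smul (ssc c (Cmon a)) (ssc d (Cmon a')) = ssc (c * d) (Cmon (a @ a'))" for c d a a'
    by (simp add: smul_ssc ssc_simps Cmon_append mult.commute)
  moreover have "a @ a' \<in> comps (n + m) (r + s)" if "a \<in> comps n r" "a' \<in> comps m s" for a a'
    using that by (auto simp: comps_def)
  ultimately show ?thesis by (simp add: Cspan_sum Cspan_ssc Cspan_Cmon)
qed

lemma bihom_Cspan: "f \<in> lieCpoly \<Longrightarrow> bihom n r f \<in> Cspan n r"
proof (induction arbitrary: n r rule: lieCpoly.induct)
  case (lc_C i)
  have "[i] \<in> comps i 1" using lc_C by (simp add: comps_def)
  from Cspan_Cmon[OF this] show ?case using lc_C
    by (auto simp: bihom_bideg[OF bideg_C] Cmon_simps Cspan_zero)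
next
  case (lc_br f g)
  show ?case unfolding bihom_sbr
  proof (intro Cspan_sum)
    fix i s assume "i \<in> {..n}" "s \<in> {..r}"
    then show "sbr (bihom i s f) (bihom (n - i) (r - s) g) \<in> Cspan n r"
      using Cspan_smul[OF lc_br.IH(1)[of i s] lc_br.IH(2)[of "n - i" "r - s"]]
        Cspan_smul[OF lc_br.IH(2)[of "n - i" "r - s"] lc_br.IH(1)[of i s]]
      by (simp add: sbr_eq Cspan_diff)
  qed
qed (auto simp: sadd_eq bihom_simps intro: Cspan_add Cspan_ssc)

text \<open>An auxiliary word whose monomial is that of \<open>C_(a_1) ... C_(a_r)\<close> in the
  variables u; it transfers the independence of these products to that of words.\<close>

primrec cword :: "nat list \<Rightarrow> word" where
  "cword [] = []"
| "cword (i # a) = replicate (i - 1) False @ True # cword a"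

lemma replicate_False_True_eq:
  "replicate k False @ True # v = replicate j False @ True # u \<longleftrightarrow> k = j \<and> v = u"
proof (induction k arbitrary: j)
  case 0 then show ?case by (cases j) auto
next
  case (Suc k) then show ?case by (cases j) auto
qed

lemma cword_inj: "length a = length a' \<Longrightarrow> \<forall>i\<in>set a. 1 \<le> i \<Longrightarrow> \<forall>i\<in>set a'. 1 \<le> i \<Longrightarrow> cword a = cword a' \<Longrightarrow> a = a'"
  by (induction a a' rule: list_induct2) (auto simp: replicate_False_True_eq)

lemma cword_wds: "a \<in> comps n r \<Longrightarrow> cword a \<in> wds n r"
proof -
  have "\<forall>i\<in>set a. 1 \<le> i \<Longrightarrow> length (cword a) = sum_list a \<and> dep (cword a) = length a"
    by (induction a) (auto simp: count_list_0_iff)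
  then show "a \<in> comps n r \<Longrightarrow> cword a \<in> wds n r" by (auto simp: comps_def wds_def)
qed

lemma wev_cword: "length a \<le> length us \<Longrightarrow> wev (cword a) us = mexp a us"
proof (induction a arbitrary: us)
  case (Cons i a)
  then obtain u us' where us: "us = u # us'" "length a \<le> length us'" by (cases us) auto
  have "dep (replicate k False) = 0" for k by (simp add: count_list_0_iff)
  then show ?case using Cons us by (simp add: wev_append wev_replicate mexp_Cons)
qed simp

text \<open>Both the given relation at \<open>ys\<close> and the series \<open>g\<close> at
  \<open>zs\<close> evaluate to the polynomial with coefficients \<open>k a\<close>, once
  \<open>diffs ys\<close> consists of all entries of \<open>zs\<close> but the last. Since
  \<open>diffs\<close> is surjective, that polynomial vanishes everywhere, hence so do the
  coefficients of \<open>g\<close>.\<close>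

lemma Cmon_independent:
  assumes z: "(\<Sum>a\<in>comps n r. ssc (k a) (Cmon a)) = 0" and a: "a \<in> comps n r"
  shows "k a = 0"
proof -
  define g where "g = (\<Sum>a\<in>comps n r. ssc (k a) (smono (cword a)))"
  have gf_smono: "gf (smono w) n r zs = wev w zs" if "w \<in> wds n r" for w zs
    using that by (simp add: gf_def smono_apply if_distrib[of "\<lambda>x. x * _"] cong: if_cong)
  have "g (cword a) = 0"
  proof (rule gf_zero_imp_zero[OF _ cword_wds[OF a]])
    fix zs :: "rat list" assume zs: "length zs = Suc r"
    obtain ys where ys: "length ys = Suc r" "diffs ys = butlast zs"
      using diffs_surj[of "butlast zs"] zs by auto
    have mexp: "mexp a zs = mexp a (butlast zs)" if "length a = r" for a
      using that zs unfolding mexp_def by (intro prod.cong) (auto simp: nth_butlast)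
    have "gf g n r zs = (\<Sum>a\<in>comps n r. k a * wev (cword a) zs)"
      by (simp add: g_def gf_sum gf_simps gf_smono cword_wds)
    also have "\<dots> = (\<Sum>a\<in>comps n r. k a * mexp a (diffs ys))"
      using zs by (intro sum.cong) (auto simp: comps_def wev_cword mexp ys)
    also have "\<dots> = (\<Sum>a\<in>comps n r. gf (ssc (k a) (Cmon a)) n r ys)"
      using ys gf_Cmon by (intro sum.cong) (auto simp: comps_def gf_simps)
    also have "\<dots> = gf (\<Sum>a\<in>comps n r. ssc (k a) (Cmon a)) n r ys" by (simp only: gf_sum)
    finally show "gf g n r zs = 0" by (simp add: z gf_simps)
  qed
  moreover have "g (cword a) = (\<Sum>a'\<in>comps n r. if a' = a then k a else 0)"
    unfolding g_def sum_apply using a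
    by (intro sum.cong) (auto simp: pw smono_apply comps_def dest: cword_inj[rotated 3])
  ultimately show ?thesis using a by simp
qed

lemma Ccoeff_expansion:
  assumes "bihom n r b \<in> Cspan n r"
  shows "bihom n r b = (\<Sum>a\<in>comps n r. ssc (Ccoeff b a) (Cmon a))"
proof -
  obtain k0 where k0: "bihom n r b = (\<Sum>a\<in>comps n r. ssc (k0 a) (Cmon a))"
    using assms unfolding Cspan_def by blast
  \<comment> \<open>The description in \<open>Ccoeff\<close> asks for the value 0 outside
    \<open>comps\<close>; without this normalization it would not be unique.\<close>
  define k where "k a = (if a \<in> comps n r then k0 a else 0)" for a
  have k: "bihom n r b = (\<Sum>a\<in>comps n r. ssc (k a) (Cmon a))"
    unfolding k0 by (intro sum.cong) (auto simp: k_def)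
  let ?P = "\<lambda>k. (\<forall>a'. a' \<notin> comps n r \<longrightarrow> k a' = 0) \<and> bihom n r b = (\<lambda>w. \<Sum>a'\<in>comps n r. k a' * Cmon a' w)"
  have "(THE k. ?P k) = k"
  proof (rule the_equality)
    show "?P k" unfolding k by (auto simp: k_def fun_eq_iff sum_apply pw)
    fix l assume l: "?P l"
    then have "bihom n r b = (\<Sum>a\<in>comps n r. ssc (l a) (Cmon a))"
      by (auto simp: fun_eq_iff sum_apply pw)
    with k have "(\<Sum>a\<in>comps n r. ssc (l a - k a) (Cmon a)) = 0"
      by (auto simp: fun_eq_iff sum_apply pw algebra_simps sum_subtractf)
    from Cmon_independent[OF this] l show "l = k" by (auto simp: fun_eq_iff k_def)
  qed
  then have "Ccoeff b a = k a" if "a \<in> comps n r" for a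
    using that unfolding Ccoeff_def comps_def by auto
  then show ?thesis unfolding k by (intro sum.cong) auto
qed

lemma lieC_bihom_Cspan: "b \<in> lieC \<Longrightarrow> bihom n r b \<in> Cspan n r"
  using bihom_Cspan[of "bihom n r b" n r] bihom_bideg[OF bideg_bihom[of n r b], of n r]
  by (simp add: lieC_iff_bihom)

lemma gf_bihom: "gf (bihom n r b) n r zs = gf b n r zs"
  by (auto simp: gf_def bihom_apply wds_def intro: sum.cong)

lemma Bmould_eq_gf:
  assumes "b \<in> lieC" "length zs = Suc r"
  shows "Bmould b n r (diffs zs) = gf b n r zs"
proof -
  have "gf b n r zs = gf (\<Sum>a\<in>comps n r. ssc (Ccoeff b a) (Cmon a)) n r zs"
    using Ccoeff_expansion[OF lieC_bihom_Cspan[OF assms(1)]] gf_bihom by metis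
  also have "\<dots> = (\<Sum>a\<in>comps n r. Ccoeff b a * mexp a (diffs zs))"
    unfolding gf_sum gf_simps using gf_Cmon assms by (intro sum.cong) (auto simp: comps_def)
  also have "\<dots> = Bmould b n r (diffs zs)"
    unfolding Bmould_def mexp_def by (intro sum.cong) (auto simp: comps_def)
  finally show ?thesis by simp
qed

section \<open>Push-invariance of the mould\<close>

text \<open>The rotation of exponent tuples, written on words. With an extra y in front it is the
  passage of a cyclic word from one y to the next, which links it with \<open>cyc\<close>
  later.\<close>

definition wrot :: "word \<Rightarrow> word" where
  "wrot w = (case dropWhile Not w of [] \<Rightarrow> w | _ # v \<Rightarrow> v @ True # replicate (length (takeWhile Not w)) False)"

lemma wrot_replicate [simp]: "wrot (replicate k False) = replicate k False"
proof -
  have "dropWhile Not (replicate k False) = []" by (induction k) auto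
  then show ?thesis by (simp add: wrot_def)
qed

lemma wrot_replicate_True [simp]: "wrot (replicate k False @ True # v) = v @ True # replicate k False"
proof -
  have "dropWhile Not (replicate k False @ True # v) = True # v" "takeWhile Not (replicate k False @ True # v) = replicate k False"
    by (induction k) auto
  then show ?thesis by (simp add: wrot_def)
qed

lemma wpush_iff_wrot: "wpush b \<longleftrightarrow> (\<forall>w. b (wrot w) = b w)"
proof
  assume "wpush b"
  then show "\<forall>w. b (wrot w) = b w"
    by (metis word_cases wpush_def wrot_replicate wrot_replicate_True)
next
  assume "\<forall>w. b (wrot w) = b w"
  then show "wpush b" unfolding wpush_def by (metis wrot_replicate_True)
qed

lemma dep_replicate [simp]: "dep (replicate k False) = 0" by (simp add: count_list_0_iff)

lemma snoc_replicate_eq: "v @ True # replicate k False = u @ True # replicate j False \<longleftrightarrow> k = j \<and> v = u"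
  using replicate_False_True_eq[of k "rev v" j "rev u"] 
  by (metis rev_append rev.simps(2) rev_replicate rev_rev_ident append_Cons append_Nil append_assoc)

lemma wrot_wds: "w \<in> wds n r \<Longrightarrow> wrot w \<in> wds n r"
  by (cases w rule: word_cases) (auto simp: wds_def)

lemma bij_wrot: "bij_betw wrot (wds n r) (wds n r)"
proof -
  have "inj_on wrot (wds n r)"
  proof (rule inj_onI)
    fix w w' assume "w \<in> wds n r" "w' \<in> wds n r" "wrot w = wrot w'"
    then show "w = w'"
      by (cases w rule: word_cases; cases w' rule: word_cases) (auto simp: wds_def snoc_replicate_eq)
  qed
  moreover have "wrot ` wds n r \<subseteq> wds n r" using wrot_wds by auto
  ultimately show ?thesis using endo_inj_surj[of "wds n r" wrot] by (simp add: bij_betw_def)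
qed

lemma wev_wrot:
  assumes "w \<in> wds n r" "length zs = Suc r"
  shows "wev (wrot w) (rotate1 zs) = wev w zs"
proof (cases w rule: word_cases)
  case (1 k)
  then have "r = 0" using assms by (simp add: wds_def)
  then obtain z where "zs = [z]" using assms by (metis length_0_conv length_Suc_conv)
  then show ?thesis using 1 by simp
next
  case (2 k v)
  then have r: "r = Suc (dep v)" using assms by (simp add: wds_def)
  then obtain z ys where zs: "zs = z # ys" "length ys = Suc (dep v)" using assms by (cases zs) auto
  have "tl (drop (dep v) (ys @ [z])) = [z]"
    using zs by (metis append_Nil drop_Suc drop_all drop_append le_refl tl_drop diff_self_eq_0 drop0)
  then have "wev (v @ True # replicate k False) (ys @ [z]) = wev v ys * z ^ k"
    using zs by (simp add: wev_append wev_append_list wev_replicate)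
  moreover have "wev (replicate k False @ True # v) (z # ys) = z ^ k * wev v ys"
    by (simp add: wev_append wev_replicate)
  ultimately show ?thesis using 2 zs by simp
qed

lemma gf_rotate1:
  assumes "length zs = Suc r"
  shows "gf f n r (rotate1 zs) = gf (\<lambda>w. f (wrot w)) n r zs"
proof -
  have "gf f n r (rotate1 zs) = (\<Sum>w\<in>wds n r. f (wrot w) * wev (wrot w) (rotate1 zs))"
    unfolding gf_def by (rule sum.reindex_bij_betw[OF bij_wrot, symmetric])
  also have "\<dots> = gf (\<lambda>w. f (wrot w)) n r zs"
    unfolding gf_def using assms by (intro sum.cong) (auto simp: wev_wrot)
  finally show ?thesis .
qed

lemma gf_rotate:
  "length zs = Suc r \<Longrightarrow> gf f n r (rotate i zs) = gf (\<lambda>w. f ((wrot ^^ i) w)) n r zs"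
proof (induction i arbitrary: f)
  case (Suc i)
  have "gf f n r (rotate (Suc i) zs) = gf (\<lambda>w. f (wrot w)) n r (rotate i zs)"
    using Suc.prems by (simp add: gf_rotate1)
  then show ?case using Suc.IH[OF Suc.prems, of "\<lambda>w. f (wrot w)"] by simp
qed simp

lemma gf_rotate1_wpush: "wpush b \<Longrightarrow> length zs = Suc r \<Longrightarrow> gf b n r (rotate1 zs) = gf b n r zs"
  by (simp add: gf_rotate1 wpush_iff_wrot)

lemma distinct_diffs: "distinct zs \<Longrightarrow> 0 \<notin> set (diffs zs)"
  by (induction zs rule: diffs.induct) auto

lemma good_iff: "good us \<longleftrightarrow> 0 \<notin> set us \<and> sum_list us \<noteq> 0"
  by (auto simp: good_def)

text \<open>In the variables z the denominator is the product of consecutive differences and of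
  first minus last. Moving \<open>z\<close> from the front to the back flips two signs, so both
  denominators are the same \<open>P\<close>.\<close>

lemma Bstar_rotate:
  fixes z :: rat
  assumes "b \<in> lieC" "length ys = r" "ys \<noteq> []"
  defines "P \<equiv> prod_list (diffs ys) * (z - hd ys) * (z - last ys)"
  shows "Bstar b n r (diffs (z # ys)) = gf b n r (z # ys) / P"
    "Bstar b n r (diffs (ys @ [z])) = gf b n r (ys @ [z]) / P"
proof -
  have P: "prod_list (diffs (z # ys)) * sum_list (diffs (z # ys)) = P"
    using assms(3) by (simp add: sum_list_diffs) (simp add: P_def diffs_Cons)
  have P': "prod_list (diffs (ys @ [z])) * sum_list (diffs (ys @ [z])) = P"
    using assms(3) by (simp add: sum_list_diffs) (simp add: P_def diffs_snoc algebra_simps)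
  show "Bstar b n r (diffs (z # ys)) = gf b n r (z # ys) / P"
    unfolding Bstar_def P using assms by (subst Bmould_eq_gf) auto
  show "Bstar b n r (diffs (ys @ [z])) = gf b n r (ys @ [z]) / P"
    unfolding Bstar_def P' using assms by (subst Bmould_eq_gf) auto
qed

text \<open>The sum of the differences telescopes, so \<open>u_0\<close> is
  \<open>z - hd ys\<close>; the push is a rotation of the variables z.\<close>

lemma push_point:
  assumes "ys \<noteq> []"
  shows "(- sum_list (diffs (ys @ [z]))) # butlast (diffs (ys @ [z])) = diffs (z # ys)"
  using assms by (simp add: sum_list_diffs) (simp add: diffs_snoc diffs_Cons)

lemma push_inv_iff_wpush:
  assumes b: "b \<in> lieC"
  shows "push_inv b \<longleftrightarrow> wpush b"
proof
  assume push: "push_inv b"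
  show "wpush b" unfolding wpush_iff_wrot
  proof
    fix w
    define n r where "n = length w" "r = dep w"
    show "b (wrot w) = b w"
    \<comment> \<open>Push-invariance starts at depth 1; words without y are fixed by
      \<open>wrot\<close>.\<close>
    proof (cases "r = 0")
      case True
      then show ?thesis by (cases w rule: word_cases) (auto simp: n_r_def)
    next
      case False
      define f where "f = (\<lambda>w. b (wrot w)) - b"
      have "f w = 0"
      proof (rule gf_zero_imp_zero[of r f n])
        show "w \<in> wds n r" by (simp add: wds_def n_r_def)
        fix zs :: "rat list" assume "length zs = Suc r"
        then show "gf f n r zs = 0"
        proof (rule gf_generic_zero[rotated])
          fix zs :: "rat list" assume zs: "length zs = Suc r" "distinct zs" "0 \<notin> set zs"
          then obtain z ys where zy: "zs = z # ys" "length ys = r" by (cases zs) auto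
          then have ys: "ys \<noteq> []" "distinct (ys @ [z])" using False zs by auto
          have hl: "hd ys \<in> set ys" "last ys \<in> set ys" using ys by auto
          then have nz: "z - hd ys \<noteq> 0" "z - last ys \<noteq> 0" "prod_list (diffs ys) \<noteq> 0"
            using ys distinct_diffs[of ys] by (auto simp: prod_list_zero_iff)
          \<comment> \<open>Distinct variables keep the denominator away from 0, so that it can be
            cancelled.\<close>
          have "good (diffs (ys @ [z]))"
            using distinct_diffs[OF ys(2)] ys(1) nz by (simp add: good_iff sum_list_diffs)
          then have "Bstar b n r (diffs (z # ys)) = Bstar b n r (diffs (ys @ [z]))"
            using push ys zy False push_point[OF ys(1), of z] unfolding push_inv_def by (metis One_nat_def Suc_leI
              bot_nat_0.not_eq_extremum diff_Suc_1 length_append_singleton length_diffs)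
          then have "gf b n r (z # ys) = gf b n r (ys @ [z])"
            using nz by (simp add: Bstar_rotate[OF b zy(2) ys(1)])
          then show "gf f n r zs = 0"
            using gf_rotate1[of zs r b n] zs zy by (simp add: f_def gf_simps)
        qed
      qed
      then show ?thesis by (simp add: f_def pw)
    qed
  qed
next
  assume wp: "wpush b"
  show "push_inv b" unfolding push_inv_def
  proof (intro allI impI)
    fix n r us assume r: "1 \<le> r" "length us = r" and "good us"
    obtain zs where zs: "length zs = Suc r" "diffs zs = us" using diffs_surj[of us] r by auto
    then obtain ys z where zy: "zs = ys @ [z]" "length ys = r" by (cases zs rule: rev_cases) auto
    then have ys: "ys \<noteq> []" using r by auto
    have "gf b n r (ys @ [z]) = gf b n r (z # ys)"
      using gf_rotate1_wpush[OF wp, of "z # ys" r n] zy by simp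
    then show "Bstar b n r ((- sum_list us) # butlast us) = Bstar b n r us"
      using push_point[OF ys, of z] zs zy by (simp add: Bstar_rotate[OF b zy(2) ys] flip: zs(2))
  qed
qed

section \<open>Circ-neutrality and the divergence\<close>

lemma sum_lessThan_add: "(\<Sum>i<a + b. h i) = (\<Sum>i<a. h i) + (\<Sum>i<b. h (i + a))" for h :: "nat \<Rightarrow> rat"
  by (induction b) (auto simp: algebra_simps)

text \<open>Rotations of the concatenation are grouped by the block in which they start; the blocks
  in front of it amount to a rotation of the list of blocks.\<close>

lemma sum_rotate_concat:
  fixes h :: "'a list \<Rightarrow> rat"
  shows "(\<Sum>i<length (concat ws). h (rotate i (concat ws))) =
    (\<Sum>j<length ws. \<Sum>i<length (ws ! j). h (rotate i (concat (rotate j ws))))"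
proof -
  have "k \<le> length ws \<Longrightarrow> (\<Sum>i<length (concat (take k ws)). h (rotate i (concat ws))) =
    (\<Sum>j<k. \<Sum>i<length (ws ! j). h (rotate i (concat (rotate j ws))))" for k
  proof (induction k)
    case (Suc k)
    let ?a = "length (concat (take k ws))"
    have ws: "concat ws = concat (take k ws) @ concat (drop k ws)"
      by (metis append_take_drop_id concat_append)
    have "rotate k ws = drop k ws @ take k ws"
      using Suc.prems rotate_append[of "take k ws" "drop k ws"] by simp
    then have rot: "rotate ?a (concat ws) = concat (rotate k ws)"
      by (subst ws, subst rotate_append) simp
    have "concat (take (Suc k) ws) = concat (take k ws) @ ws ! k"
      using Suc.prems by (simp add: take_Suc_conv_app_nth)
    then have "(\<Sum>i<length (concat (take (Suc k) ws)). h (rotate i (concat ws))) =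
      (\<Sum>i<?a. h (rotate i (concat ws))) + (\<Sum>i<length (ws ! k). h (rotate (i + ?a) (concat ws)))"
      by (simp only: length_append sum_lessThan_add)
    also have "(\<Sum>i<length (ws ! k). h (rotate (i + ?a) (concat ws))) = (\<Sum>i<length (ws ! k). h (rotate i (concat (rotate k ws))))"
      by (simp only: rot flip: rotate_rotate)
    finally show ?case using Suc by simp
  qed simp
  from this[of "length ws"] show ?thesis by simp
qed

abbreviation blk :: "nat \<Rightarrow> word" where "blk a \<equiv> True # replicate a False"

lemma ex_blocks: "\<exists>gs. True # u = concat (map blk gs) \<and> length gs = Suc (dep u)"
proof (induction u)
  case Nil show ?case by (rule exI[of _ "[0]"]) simp
next
  case (Cons c u)
  then obtain gs where gs: "True # u = concat (map blk gs)" "length gs = Suc (dep u)" by blast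
  show ?case
  proof (cases c)
    case True
    then show ?thesis using gs(2) by (intro exI[of _ "0 # gs"]) (simp flip: gs(1))
  next
    case False
    obtain g gs' where "gs = g # gs'" using gs(2) by (cases gs) auto
    then show ?thesis using gs False by (intro exI[of _ "Suc g # gs'"]) simp
  qed
qed

lemma blocks_rotate1: "True # u = concat (map blk gs) \<Longrightarrow> True # wrot u = concat (map blk (rotate1 gs))"
proof (cases gs)
  case (Cons g gs')
  assume u: "True # u = concat (map blk gs)"
  show ?thesis
  proof (cases gs')
    case Nil then show ?thesis using Cons u by simp
  next
    case (Cons g' gs'')
    then have "u = replicate g False @ True # replicate g' False @ concat (map blk gs'')"
      using u \<open>gs = g # gs'\<close> by simp
    then show ?thesis using Cons \<open>gs = g # gs'\<close> by simp
  qed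
qed simp

lemma blocks_rotate: "True # u = concat (map blk gs) \<Longrightarrow> True # (wrot ^^ j) u = concat (map blk (rotate j gs))"
proof (induction j)
  case (Suc j) then show ?case using blocks_rotate1[of "(wrot ^^ j) u" "rotate j gs"] by simp
qed simp

text \<open>Only rotations that begin with y survive. There is one for each y of the cyclic word,
  and deleting the leading y leaves the successive \<open>wrot\<close> images of
  \<open>u\<close>.\<close>

lemma cyc_sY_smul: "cyc (smul sY g) (True # u) = (\<Sum>j<Suc (dep u). g ((wrot ^^ j) u))"
proof -
  obtain gs where gs: "True # u = concat (map blk gs)" "length gs = Suc (dep u)" using ex_blocks by blast
  have "cyc (smul sY g) (True # u) = (\<Sum>j<length gs. \<Sum>i<length (map blk gs ! j). smul sY g (rotate i (concat (rotate j (map blk gs)))))"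
    unfolding cyc_def gs(1) sum_rotate_concat by simp
  also have "\<dots> = (\<Sum>j<length gs. g ((wrot ^^ j) u))"
  proof (rule sum.cong[OF refl])
    fix j assume "j \<in> {..<length gs}"
    then have j: "j < length gs" by simp
    define q where "q = concat (rotate j (map blk gs))"
    have q: "q = True # (wrot ^^ j) u" using blocks_rotate[OF gs(1)] by (simp add: q_def rotate_map)
    have "gs \<noteq> []" using gs(2) by auto
    then obtain t where t: "rotate j gs = gs ! j # t"
      using j by (metis hd_rotate_conv_nth list.collapse mod_less rotate_is_Nil_conv)
    have q': "q = blk (gs ! j) @ concat (map blk t)"
      by (simp add: q_def rotate_map t)
    \<comment> \<open>Inside one block every start other than its first position is at an x.\<close>
    have "(\<Sum>i<length (map blk gs ! j). smul sY g (rotate i q)) = (\<Sum>i<Suc (gs ! j). if i = 0 then g ((wrot ^^ j) u) else 0)"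
    proof (rule sum.cong)
      show "{..<length (map blk gs ! j)} = {..<Suc (gs ! j)}" using j by simp
      fix i assume "i \<in> {..<Suc (gs ! j)}"
      then have i: "i \<le> gs ! j" by simp
      show "smul sY g (rotate i q) = (if i = 0 then g ((wrot ^^ j) u) else 0)"
      proof (cases "i = 0")
        case True then show ?thesis by (simp add: q sY_eq)
      next
        case False
        have "hd (rotate i q) = q ! i"
          using i q' by (subst hd_rotate_conv_nth) auto
        also have "\<dots> = False" using i False unfolding q' by (cases i) (auto simp: nth_append)
        finally obtain v where "rotate i q = False # v"
          by (metis (full_types) hd_Cons_tl list.distinct(1) q rotate_is_Nil_conv)
        then show ?thesis using False by (simp add: sY_eq)
      qed
    qed
    also have "\<dots> = g ((wrot ^^ j) u)" by simp
    finally show "(\<Sum>i<length (map blk gs ! j). smul sY g (rotate i (concat (rotate j (map blk gs))))) = g ((wrot ^^ j) u)"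
      by (simp only: q_def)
  qed
  finally show ?thesis using gs(2) by simp
qed

lemma gf_cyc_sY_smul:
  assumes "length zs = Suc s"
  shows "gf (\<lambda>u. cyc (smul sY g) (True # u)) m s zs = (\<Sum>i<Suc s. gf g m s (rotate i zs))"
proof -
  have "gf (\<lambda>u. cyc (smul sY g) (True # u)) m s zs = (\<Sum>u\<in>wds m s. \<Sum>i<Suc s. g ((wrot ^^ i) u) * wev u zs)"
    unfolding gf_def cyc_sY_smul by (intro sum.cong) (auto simp: wds_def sum_distrib_right simp del: sum.lessThan_Suc)
  also have "\<dots> = (\<Sum>i<Suc s. gf (\<lambda>u. g ((wrot ^^ i) u)) m s zs)"
    unfolding gf_def by (rule sum.swap)
  finally show ?thesis using gf_rotate[OF assms] by simp
qed

text \<open>The remainder of \<open>b(wx) - b(xw)\<close> once a y has been rotated to the front and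
  removed: the difference of appending and prepending x, for the part of \<open>b\<close> behind a
  leading y.\<close>

definition Gm :: "ser \<Rightarrow> ser" where
  "Gm b = rder False (lder True b) - lder False (lder True b)"

lemma cyc_uminus: "cyc (- f) = - cyc f"
  by (simp add: cyc_def fun_eq_iff pw sum_negf)

text \<open>The parts of both series that come from words \<open>x u x\<close> are
  \<open>x B\<close> and \<open>B x\<close>, which agree cyclically. The remaining parts contain a y
  that can be rotated to the front.\<close>

lemma cyc_rder_minus_lder:
  assumes "wpush b"
  shows "cyc (rder False b - lder False b) = cyc (smul sY (Gm b))"
proof -
  define B where "B = rder False (lder False b)"
  have 1: "rder False b = ssc (b [False]) sone + smul (ltr False) B + smul sY (rder False (lder True b))"
  proof -
    have "lder c (rder False b) = rder False (lder c b)" for c by (simp add: fun_eq_iff)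
    then show ?thesis by (subst ser_decomp) (simp add: B_def sY_eq)
  qed
  have 2: "lder False b = ssc (b [False]) sone + smul B (ltr False) + smul (lder False (lder True b)) sY"
  proof -
    \<comment> \<open>This is push-invariance with leading exponent 0: a y may move from one end of
      a word to the other.\<close>
    have "rder True (lder False b) = lder False (lder True b)"
    proof
      fix u show "rder True (lder False b) u = lder False (lder True b) u"
        using assms[unfolded wpush_def, rule_format, of 0 "False # u"] by simp
    qed
    then show ?thesis by (subst ser_decomp_right) (simp add: B_def sY_eq)
  qed
  show ?thesis
    unfolding Gm_def by (subst 1, subst 2)
      (simp add: cyc_simps cyc_uminus smul_simps cyc_smul_commute[of B] cyc_smul_commute[of "lder False (lder True b)"])
qed

section \<open>Powers of [x,y] and the rotation-invariant product\<close>

primrec spow :: "nat \<Rightarrow> ser" where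
  "spow 0 = sone"
| "spow (Suc r) = smul (sbr sX sY) (spow r)"

lemma spow_eq_Cmon: "spow r = Cmon (replicate r 2)"
proof (induction r)
  case (Suc r)
  have "C 2 = sbr sX sY" using C_Suc_Suc[of 0] by (simp add: C_Suc_0 numeral_2_eq_2)
  then show ?case using Suc by (simp add: Cmon_simps)
qed (simp add: Cmon_simps)

lemma bideg_spow: "bideg (2 * r) r (spow r)"
  using bideg_Cmon[of "replicate r 2"] by (simp add: spow_eq_Cmon sum_list_replicate mult.commute)

lemma mexp_replicate_2: "length us = s \<Longrightarrow> mexp (replicate s 2) us = prod_list us"
  by (induction us arbitrary: s) (auto simp: mexp_Cons)

text \<open>Since \<open>[x,y] = C 2\<close>, each factor contributes one variable
  \<open>u_i\<close> to the first power, which gives the product of all differences.\<close>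

lemma gf_spow: "length zs = Suc s \<Longrightarrow> gf (spow s) m s zs = (if m = 2 * s then prod_list (diffs zs) else 0)"
proof -
  assume zs: "length zs = Suc s"
  have "gf (spow s) m s zs = 0" if "m \<noteq> 2 * s"
    unfolding gf_def using that bideg_spow[of s] by (intro sum.neutral) (auto simp: bideg_def wds_def)
  moreover have "gf (spow s) (2 * s) s zs = prod_list (diffs zs)"
    using gf_Cmon[of "replicate s 2" zs] zs mexp_replicate_2[of "diffs zs" s]
    by (simp add: spow_eq_Cmon sum_list_replicate mult.commute)
  ultimately show ?thesis by auto
qed

text \<open>The counterpart of \<open>Gm\<close> for \<open>[x,y]^(s+1)\<close>: with
  \<open>P = [x,y]^s\<close>, the word sum \<open>xyP - yxP\<close> agrees cyclically with
  \<open>y(Px - xP)\<close>.\<close>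

definition Dm :: "nat \<Rightarrow> ser" where "Dm s = smul (spow s) sX - smul sX (spow s)"

lemma cyc_spow_Suc: "cyc (spow (Suc s)) = cyc (smul sY (Dm s))"
proof -
  have "spow (Suc s) = smul sX (smul sY (spow s)) - smul sY (smul sX (spow s))"
    by (simp add: sbr_eq smul_simps smul_assoc)
  then show ?thesis
    by (simp add: cyc_simps Dm_def smul_simps cyc_smul_commute[of sX "smul sY (spow s)"] smul_assoc del: spow.simps)
qed

definition Pc :: "rat list \<Rightarrow> rat" where "Pc zs = prod_list (diffs zs) * (last zs - hd zs)"

lemma Pc_rotate1: "Pc (rotate1 zs) = Pc zs"
proof (cases zs)
  case (Cons z ys)
  then show ?thesis by (cases "ys = []") (auto simp: Pc_def diffs_Cons diffs_snoc)
qed simp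

lemma Pc_rotate: "Pc (rotate i zs) = Pc zs"
  by (induction i) (simp_all add: Pc_rotate1)

text \<open>Appending x multiplies by the last variable, prepending x by the first, and their
  difference closes the cycle of \<open>Pc\<close>. The degree \<open>2 * s + 1\<close> is weight
  \<open>2 * r + 1\<close> at \<open>r = s + 1\<close>, after the removal of a y and an x.\<close>

lemma gf_Dm:
  assumes "length zs = Suc s" "s \<noteq> 0"
  shows "gf (Dm s) m s zs = (if m = 2 * s + 1 then Pc zs else 0)"
proof (cases m)
  case 0
  then show ?thesis using assms by (simp add: gf_0)
next
  case (Suc k)
  have "rder False (smul (spow s) sX) = spow s" "rder True (smul (spow s) sX) = 0"
    by (simp_all add: sX_eq fun_eq_iff pw)
  then have "gf (smul (spow s) sX) (Suc k) s zs = last zs * gf (spow s) k s zs"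
    using assms by (simp add: gf_rec_right gf_simps)
  moreover have "gf (smul sX (spow s)) (Suc k) s zs = hd zs * gf (spow s) k s zs"
    by (simp add: sX_eq gf_ltr_False)
  ultimately show ?thesis using Suc assms by (simp add: Dm_def gf_simps gf_spow Pc_def algebra_simps)
qed

text \<open>Setting the last or first variable to 0 leaves the words that do not end or begin with
  x, so difference quotients extract the two derivatives. The leading 0 in the argument of
  \<open>V\<close> selects the words of \<open>b\<close> that begin with y.\<close>

lemma gf_Gm:
  fixes b :: ser and m :: nat
  assumes zs: "length zs = Suc s" and s: "s \<noteq> 0" and nz: "hd zs \<noteq> 0" "last zs \<noteq> 0"
  defines "V \<equiv> gf b (Suc (Suc m)) (Suc s)"
  shows "gf (Gm b) m s zs = (V (0 # zs) - V (0 # butlast zs @ [0])) / last zs - (V (0 # zs) - V (0 # 0 # tl zs)) / hd zs"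
proof -
  define \<beta> where "\<beta> = lder True b"
  have V: "V (0 # ys) = gf \<beta> (Suc m) s ys" for ys by (simp add: V_def gf_rec[of b] \<beta>_def)
  have "V (0 # zs) = last zs * gf (rder False \<beta>) m s zs + V (0 # butlast zs @ [0])"
    unfolding V using zs s by (subst (1 2) gf_rec_right) auto
  moreover have "V (0 # zs) = hd zs * gf (lder False \<beta>) m s zs + V (0 # 0 # tl zs)"
    unfolding V using s by (subst (1 2) gf_rec) auto
  ultimately show ?thesis using nz by (simp add: Gm_def gf_simps field_simps flip: \<beta>_def)
qed

text \<open>At \<open>z_0 = 0\<close>, multiplication by \<open>Pc\<close> turns the mould into
  \<open>V(0,u) / hd u - V(0,u) / last u\<close>, which is \<open>- gf (Gm b)\<close> up to the
  boundary values of the difference quotients. By push-invariance these are \<open>T\<close> at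
  consecutive rotations and cancel around the cycle.\<close>

lemma circ_sum:
  assumes b: "b \<in> lieC" "wpush b" and s: "s \<noteq> 0" and zs: "length zs = Suc s" "0 \<notin> set zs" "Pc zs \<noteq> 0"
  shows "Pc zs * (\<Sum>i<Suc s. Bstar b (Suc (Suc m)) (Suc s) (diffs (0 # rotate i zs))) =
    - (\<Sum>i<Suc s. gf (Gm b) m s (rotate i zs))"
proof -
  define V where "V = gf b (Suc (Suc m)) (Suc s)"
  define T where "T u = V (0 # butlast u @ [0]) / last u" for u
  have "Pc zs * Bstar b (Suc (Suc m)) (Suc s) (diffs (0 # rotate i zs)) =
      - gf (Gm b) m s (rotate i zs) - T (rotate i zs) + T (rotate (i + 1) zs)" for i
  proof -
    define u where "u = rotate i zs"
    have u: "length u = Suc s" "0 \<notin> set u" "Pc u = Pc zs" "Pc u \<noteq> 0"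
      using zs by (simp_all add: u_def Pc_rotate)
    then obtain h t where ht: "u = h # t" by (cases u) auto
    have hl: "hd u \<noteq> 0" "last u \<noteq> 0" using u by (metis hd_in_set last_in_set list.size(3) nat.simps(3))+
    have p: "prod_list (diffs u) \<noteq> 0" using u by (auto simp: Pc_def)
    have ne: "u \<noteq> []" using ht by simp
    have "Bstar b (Suc (Suc m)) (Suc s) (diffs (0 # u)) = V (0 # u) / (prod_list (diffs u) * hd u * last u)"
      using Bstar_rotate(1)[OF b(1) u(1) ne, of "Suc (Suc m)" 0] by (simp add: V_def)
    then have 1: "Pc u * Bstar b (Suc (Suc m)) (Suc s) (diffs (0 # u)) = V (0 # u) / hd u - V (0 # u) / last u"
      using p hl unfolding Pc_def by (simp add: field_simps)
    \<comment> \<open>Rotating the tuple \<open>(0, 0, t)\<close> once gives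
      \<open>(0, t, 0)\<close>, and the first entry of \<open>u\<close> is the last entry of
      \<open>rotate1 u\<close>.\<close>
    have 2: "V (0 # 0 # tl u) / hd u = T (rotate1 u)"
      using gf_rotate1_wpush[OF b(2), of "0 # 0 # t" "Suc s" "Suc (Suc m)"] u(1) by (simp add: T_def V_def ht)
    have "gf (Gm b) m s u = (V (0 # u) - V (0 # butlast u @ [0])) / last u - (V (0 # u) - V (0 # 0 # tl u)) / hd u"
      unfolding V_def by (rule gf_Gm) (use u s hl in auto)
    then have "gf (Gm b) m s u = V (0 # u) / last u - T u - V (0 # u) / hd u + T (rotate1 u)"
      unfolding 2[symmetric] by (simp add: diff_divide_distrib T_def)
    with 1 u(3) show ?thesis by (simp add: u_def)
  qed
  then have "Pc zs * (\<Sum>i<Suc s. Bstar b (Suc (Suc m)) (Suc s) (diffs (0 # rotate i zs))) =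
     - (\<Sum>i<Suc s. gf (Gm b) m s (rotate i zs)) - (\<Sum>i<Suc s. T (rotate i zs)) + (\<Sum>i<Suc s. T (rotate (i + 1) zs))"
    by (simp only: sum_distrib_left sum.distrib sum_subtractf sum_negf)
  then show ?thesis using sum_rotate_shift[of T 1 zs] zs by simp
qed

section \<open>The points of the swap in the variables z\<close>

lemma diffs_nth: "Suc j < length zs \<Longrightarrow> diffs zs ! j = zs ! j - zs ! Suc j"
proof (induction zs arbitrary: j rule: diffs.induct)
  case (1 x y zs) then show ?case by (cases j) auto
qed auto

text \<open>The swap is the choice \<open>z_0 = 0\<close> and
  \<open>z_i = - v_(r+1-i)\<close>.\<close>

lemma swap_pt_eq_diffs: "swap_pt vs = diffs (0 # map uminus (rev vs))"
proof (rule nth_equalityI)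
  show "length (swap_pt vs) = length (diffs (0 # map uminus (rev vs)))" by (simp add: swap_pt_def)
  fix j assume "j < length (swap_pt vs)"
  then have j: "j < length vs" by (simp add: swap_pt_def)
  show "swap_pt vs ! j = diffs (0 # map uminus (rev vs)) ! j"
  proof (cases j)
    case 0 then show ?thesis using j by (simp add: swap_pt_def diffs_nth rev_nth)
  next
    case (Suc i) then show ?thesis using j by (simp add: swap_pt_def diffs_nth rev_nth)
  qed
qed

text \<open>Reversing a list inverts its rotations, which only permutes the terms of the full cyclic
  sum.\<close>

lemma sum_swap_rotate:
  fixes H :: "rat list \<Rightarrow> rat"
  shows "(\<Sum>i<length vs. H (swap_pt (rotate i vs))) = (\<Sum>i<length vs. H (diffs (0 # rotate i (map uminus (rev vs)))))"
proof -
  define zs where "zs = map uminus (rev vs)"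
  let ?h = "\<lambda>u. H (diffs (0 # u))"
  have "map uminus (rev (rotate i vs)) = rotate (length vs - Suc i + 1) zs" if "i < length vs" for i
  proof -
    have "rev (rotate i vs) = rotate (length vs - i) (rev vs)"
      using that rotate_append[of "rev (drop i vs)" "rev (take i vs)"] 
      by (simp add: rotate_drop_take flip: rev_append)
    then show ?thesis using that by (simp add: zs_def rotate_map Suc_diff_Suc)
  qed
  then have "(\<Sum>i<length vs. H (swap_pt (rotate i vs))) = (\<Sum>i<length vs. ?h (rotate (length vs - Suc i + 1) zs))"
    by (intro sum.cong) (auto simp: swap_pt_eq_diffs)
  also have "\<dots> = (\<Sum>i<length vs. ?h (rotate (i + 1) zs))"
    by (rule sum.nat_diff_reindex[where g="\<lambda>i. ?h (rotate (i + 1) zs)"])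
  also have "\<dots> = (\<Sum>i<length vs. ?h (rotate i zs))"
    using sum_rotate_shift[of ?h 1 zs] by (simp add: zs_def)
  finally show ?thesis by (simp add: zs_def)
qed

text \<open>The infinite sum of multiples of \<open>[x,y]^r\<close>; powers with \<open>r\<close>
  above the length of the word cannot contribute.\<close>

definition spow_series :: "(nat \<Rightarrow> rat) \<Rightarrow> ser" where
  "spow_series N = (\<lambda>v. \<Sum>r\<le>length v. N r * spow r v)"

lemma spow_series_apply: "spow_series N v = N (dep v) * spow (dep v) v"
proof -
  have "spow_series N v = (\<Sum>r\<le>length v. if r = dep v then N (dep v) * spow (dep v) v else 0)"
    unfolding spow_series_def using bideg_spow by (intro sum.cong) (auto simp: bideg_def)
  then show ?thesis using count_le_length[of v True] by simp
qed

lemma dep_rotate: "dep (rotate i w) = dep w"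
  by (metis append_take_drop_id count_list_append rotate_drop_take add.commute)

lemma cyc_rotate: "cyc h (rotate k w) = cyc h w"
  using sum_rotate_shift[of h k w] by (simp add: cyc_def rotate_rotate)

lemma circ_ok_imp_cyc:
  assumes b: "b \<in> lieC" "wpush b" and "circ_ok b"
  shows "\<exists>N. cyc (rder False b - lder False b) = cyc (spow_series N)"
proof -
  obtain M0 :: "nat \<Rightarrow> rat" where M0: "\<And>r n vs. 1 < r \<Longrightarrow> length vs = r \<Longrightarrow>
      \<forall>i<r. good (swap_pt (rotate i vs)) \<Longrightarrow>
      (\<Sum>i<r. Bstar b n r (swap_pt (rotate i vs))) + (if n = 2 * r + 1 then of_nat r * M0 r else 0) = 0"
    using assms(3) unfolding circ_ok_def by blast
  \<comment> \<open>Circ-neutrality is silent for \<open>r\<close> at most 1. There the divergence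
    vanishes by itself, so these coefficients must be set to 0.\<close>
  define N where "N r = (if r \<le> 1 then 0 else M0 r)" for r
  \<comment> \<open>The relation at \<open>z_0 = 0\<close> controls words that begin with y;
    rotation invariance of \<open>cyc\<close> carries the result to all words containing
    one.\<close>
  have start_y: "cyc (smul sY (Gm b)) (True # u) = cyc (spow_series N) (True # u)" for u
  proof -
    define m s where "m = length u" "s = dep u"
    have "cyc (spow_series N) (True # u) = N (Suc s) * cyc (spow (Suc s)) (True # u)"
      by (simp add: cyc_def spow_series_apply dep_rotate m_s_def sum_distrib_left del: spow.simps sum.lessThan_Suc)
    then have g: "cyc (spow_series N) (True # u) = N (Suc s) * cyc (smul sY (Dm s)) (True # u)"
      by (simp only: cyc_spow_Suc)
    show ?thesis
    proof (cases "s = 0")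
      case True
      then obtain k where "u = replicate k False" by (cases u rule: word_cases) (auto simp: m_s_def)
      then have "Gm b u = 0" by (simp add: Gm_def pw replicate_append_same)
      then show ?thesis unfolding g using True by (simp add: N_def cyc_sY_smul m_s_def)
    next
      case s: False
      define e where "e = (\<lambda>u. cyc (smul sY (Gm b)) (True # u)) - ssc (N (Suc s)) (\<lambda>u. cyc (smul sY (Dm s)) (True # u))"
      have "e u = 0"
      proof (rule gf_zero_imp_zero[of s e m])
        show "u \<in> wds m s" by (simp add: wds_def m_s_def)
        fix zs :: "rat list" assume "length zs = Suc s"
        then show "gf e m s zs = 0"
        proof (rule gf_generic_zero[rotated])
          fix zs :: "rat list" assume zs: "length zs = Suc s" "distinct zs" "0 \<notin> set zs"
          \<comment> \<open>Chosen so that the swapped rotations of \<open>vs\<close> are the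
            differences of 0 followed by the rotations of \<open>zs\<close>.\<close>
          define vs where "vs = rev (map uminus zs)"
          have vs: "length vs = Suc s" "map uminus (rev vs) = zs"
            using zs by (simp_all add: vs_def rev_map comp_def)
          have gd: "good (swap_pt (rotate i vs))" for i
          proof -
            define ys where "ys = map uminus (rev (rotate i vs))"
            have ys: "distinct ys" "0 \<notin> set ys" "ys \<noteq> []"
              using zs s by (auto simp: ys_def vs_def distinct_map inj_on_def rev_map image_iff)
            then have "distinct (0 # ys)" "last ys \<noteq> 0" using last_in_set[of ys] by (simp, metis)
            then show ?thesis unfolding swap_pt_eq_diffs ys_def[symmetric] good_iff
              using distinct_diffs[of "0 # ys"] sum_list_diffs[of "0 # ys"] ys(3) by simp
          qed
          have hl: "last zs \<noteq> hd zs" using zs(1,2) s by (cases zs) (auto simp: last_in_set)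
          have Pc: "Pc zs \<noteq> 0" using hl distinct_diffs[OF zs(2)] by (simp add: Pc_def prod_list_zero_iff)
          let ?S = "\<Sum>i<Suc s. Bstar b (Suc (Suc m)) (Suc s) (diffs (0 # rotate i zs))"
          have "(\<Sum>i<Suc s. Bstar b (Suc (Suc m)) (Suc s) (swap_pt (rotate i vs))) = ?S"
            using sum_swap_rotate[of "Bstar b (Suc (Suc m)) (Suc s)" vs] vs by simp
          \<comment> \<open>The weight condition \<open>n = 2 * r + 1\<close> reads
            \<open>m = 2 * s + 1\<close> here, because \<open>n = m + 2\<close> and
            \<open>r = s + 1\<close>.\<close>
          then have S: "?S = - (if m = 2 * s + 1 then of_nat (Suc s) * N (Suc s) else 0)"
            using M0[of "Suc s" vs "Suc (Suc m)"] vs gd s by (auto simp: N_def)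
          have "gf e m s zs = (\<Sum>i<Suc s. gf (Gm b) m s (rotate i zs)) - N (Suc s) * (\<Sum>i<Suc s. gf (Dm s) m s (rotate i zs))"
            by (simp only: e_def gf_simps gf_cyc_sY_smul[OF zs(1)])
          also have "(\<Sum>i<Suc s. gf (Gm b) m s (rotate i zs)) = - (Pc zs * ?S)"
            using circ_sum[OF b s zs(1,3) Pc, of m] by simp
          also have "(\<Sum>i<Suc s. gf (Dm s) m s (rotate i zs)) = of_nat (Suc s) * (if m = 2 * s + 1 then Pc zs else 0)"
            using zs s by (simp add: gf_Dm Pc_rotate algebra_simps)
          finally show "gf e m s zs = 0" unfolding S by simp
        qed
      qed
      then show ?thesis unfolding g by (simp add: e_def pw)
    qed
  qed
  have "cyc (smul sY (Gm b)) w = cyc (spow_series N) w" for w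
  proof (cases w rule: word_cases)
    case (1 k)
    have "rotate i w = w" for i using 1 by (induction i) (auto simp: rotate1_replicate)
    moreover have "smul sY (Gm b) w = 0" using 1 by (cases k) (simp_all add: sY_eq smono_apply)
    moreover have "spow_series N w = 0" using 1 by (simp add: spow_series_apply N_def)
    ultimately show ?thesis by (simp add: cyc_def)
  next
    case (2 k v)
    then have "rotate k w = True # v @ replicate k False"
      using rotate_append[of "replicate k False" "True # v"] by simp
    then show ?thesis using start_y[of "v @ replicate k False"] cyc_rotate by metis
  qed
  then show ?thesis using cyc_rder_minus_lder[OF b(2)] by (metis ext)
qed

text \<open>A divergence equal to zero means that the constant mould 0 works. The points are now
  arbitrary admissible ones, so the nonvanishing of the variables and of \<open>Pc\<close>, by which
  \<open>circ_sum\<close> divides, has to be read off from \<open>good\<close>.\<close>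

lemma cyc_zero_imp_circ_ok:
  assumes b: "b \<in> lieC" "wpush b" and z: "cyc (rder False b - lder False b) = 0"
  shows "circ_ok b"
  unfolding circ_ok_def
proof (intro exI[of _ "\<lambda>_. 0"] allI impI)
  fix r n and vs :: "rat list"
  assume r: "1 < r" and vs: "length vs = r" and gd: "\<forall>i<r. good (swap_pt (rotate i vs))"
  define zs where "zs = map uminus (rev vs)"
  have S: "(\<Sum>i<r. Bstar b n r (swap_pt (rotate i vs))) = (\<Sum>i<r. Bstar b n r (diffs (0 # rotate i zs)))"
    using sum_swap_rotate[of "Bstar b n r" vs] vs by (simp add: zs_def)
  have len: "length zs = r" using vs by (simp add: zs_def)
  have "(\<Sum>i<r. Bstar b n r (diffs (0 # rotate i zs))) = 0"
  \<comment> \<open>There are no words with more y than letters; otherwise \<open>n\<close> is at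
    least 2, as needed for writing it as \<open>m + 2\<close>.\<close>
  proof (cases "n < r")
    case True
    have "w \<notin> wds n r" for w using True count_le_length[of w True] by (auto simp: wds_def)
    then have "wds n r = {}" by blast
    then have "Bmould b n r (diffs (0 # rotate i zs)) = 0" for i
      using len by (subst Bmould_eq_gf[OF b(1)]) (auto simp: gf_def)
    then show ?thesis by (simp add: Bstar_def)
  next
    case False
    then obtain m s where ms: "n = Suc (Suc m)" "r = Suc s" "s \<noteq> 0"
      using r that[of "n - 2" "r - 1"] by simp
    have gs: "good (swap_pt (rotate i vs))" for i
      using gd r vs by (metis length_rotate mod_less_divisor rotate_conv_mod zero_less_one order_less_trans)
    have zr: "hd (map uminus (rev (rotate i vs))) \<noteq> 0 \<and> 0 \<notin> set (diffs (map uminus (rev (rotate i vs))))" for i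
    proof -
      have "map uminus (rev (rotate i vs)) \<noteq> []" using vs r by auto
      then show ?thesis using gs[of i] unfolding swap_pt_eq_diffs good_iff by (simp add: diffs_Cons)
    qed
    \<comment> \<open>Each \<open>v_i\<close> stands last in some rotation of \<open>vs\<close>,
      hence is the first coordinate of a swapped point, which is nonzero.\<close>
    have "0 \<notin> set zs"
    proof
      assume "0 \<in> set zs"
      then obtain i where i: "i < length vs" "vs ! i = 0" by (auto simp: zs_def in_set_conv_nth)
      have "hd (map uminus (rev (rotate (Suc i) vs))) = - last (rotate (Suc i) vs)"
      proof -
        have "rev (rotate (Suc i) vs) \<noteq> []" using vs r by auto
        then show ?thesis by (metis hd_map hd_rev)
      qed
      also have "last (rotate (Suc i) vs) = vs ! i"
      proof -
        have "rotate i vs \<noteq> []" using vs r by auto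
        then have "last (rotate1 (rotate i vs)) = hd (rotate i vs)" by (cases "rotate i vs") auto
        then show ?thesis using i vs by (simp add: hd_rotate_conv_nth) (metis hd_rotate_conv_nth length_0_conv less_nat_zero_code mod_less)
      qed
      finally show False using zr[of "Suc i"] i by simp
    qed
    moreover have "Pc zs \<noteq> 0"
    proof -
      obtain y ys where y: "vs = y # ys" "ys \<noteq> []" using vs r by (cases vs) auto
      have "0 \<notin> set (diffs zs)" using zr[of 0] by (simp add: zs_def)
      \<comment> \<open>The closing difference is absent from \<open>diffs zs\<close>, but it
        appears once \<open>vs\<close> is rotated by one.\<close>
      moreover have "last zs - hd zs \<noteq> 0"
      proof -
        have "diffs (map uminus (rev (rotate 1 vs))) = (- y - hd (map uminus (rev ys))) # diffs (map uminus (rev ys))"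
          using y by (simp add: diffs_Cons)
        then have "- y - hd (map uminus (rev ys)) \<noteq> 0" using zr[of 1] by auto
        then show ?thesis using y by (simp add: zs_def hd_append hd_map)
      qed
      ultimately show ?thesis by (simp add: Pc_def prod_list_zero_iff)
    qed
    moreover have "(\<Sum>i<Suc s. gf (Gm b) m s (rotate i zs)) = 0"
    proof -
      have "cyc (smul sY (Gm b)) = 0" using z cyc_rder_minus_lder[OF b(2)] by simp
      then show ?thesis using gf_cyc_sY_smul[of zs s "Gm b" m] len ms by (simp add: gf_def pw)
    qed
    ultimately show ?thesis using circ_sum[OF b ms(3), of zs m] len ms by simp
  qed
  then show "(\<Sum>i<r. Bstar b n r (swap_pt (rotate i vs))) + (if n = 2 * r + 1 then of_nat r * 0 else 0) = 0"
    by (simp add: S)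
qed

section \<open>The Lie algebra of elliptic Kashiwara--Vergne derivations\<close>

lemma krv_ell_iff: "b \<in> krv_ell \<longleftrightarrow> b \<in> lieC \<and> wpush b \<and> circ_ok b"
  unfolding krv_ell_def using push_inv_iff_wpush by blast

text \<open>\<open>Ccoeff\<close> is given by a description, so linearity is not read off directly.
  Every point is \<open>diffs zs\<close> for some \<open>zs\<close>, and there the mould is a
  generating function, which is visibly linear.\<close>

lemma Bstar_linear:
  assumes "b \<in> lieC" "b' \<in> lieC" "length us = r"
  shows "Bstar (b + b') n r us = Bstar b n r us + Bstar b' n r us"
    "Bstar (ssc c b) n r us = c * Bstar b n r us"
    "Bstar 0 n r us = 0"
proof -
  obtain zs where zs: "length zs = Suc r" "diffs zs = us" using diffs_surj[of us] assms by auto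
  have "Bmould f n r us = gf f n r zs" if "f \<in> lieC" for f
    using Bmould_eq_gf[OF that zs(1)] zs(2) by simp
  then show "Bstar (b + b') n r us = Bstar b n r us + Bstar b' n r us"
    "Bstar (ssc c b) n r us = c * Bstar b n r us" "Bstar 0 n r us = 0"
    using assms by (simp_all add: Bstar_def lieC_add lieC_ssc lieC_zero gf_simps add_divide_distrib)
qed

lemma Bstar_bihom:
  assumes "b \<in> lieC" "length us = r'"
  shows "Bstar (bihom n r b) n' r' us = (if n' = n \<and> r' = r then Bstar b n' r' us else 0)"
proof -
  obtain zs where zs: "length zs = Suc r'" "diffs zs = us" using diffs_surj[of us] assms by auto
  have M: "Bmould f n' r' us = gf f n' r' zs" if "f \<in> lieC" for f
    using Bmould_eq_gf[OF that zs(1)] zs(2) by simp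
  have "gf (bihom n r b) n' r' zs = (if n' = n \<and> r' = r then gf b n' r' zs else 0)"
    by (auto simp: gf_def bihom_apply wds_def intro!: sum.neutral)
  then show ?thesis using assms M[of b] M[of "bihom n r b"] by (auto simp: Bstar_def lieC_bihom)
qed

lemma length_swap_pt [simp]: "length (swap_pt vs) = length vs"
  by (simp add: swap_pt_def)

text \<open>Each instance of the condition concerns a single pair of weight and depth, and the
  constant of depth \<open>r\<close> occurs only in weight \<open>2 * r + 1\<close>. Constants of
  components therefore combine without conflict.\<close>

lemma circ_ok_iff_bihom:
  assumes b: "b \<in> lieC"
  shows "circ_ok b \<longleftrightarrow> (\<forall>n r. circ_ok (bihom n r b))"
proof
  assume "circ_ok b"
  then obtain M0 :: "nat \<Rightarrow> rat" where M0: "\<And>r n vs. 1 < r \<Longrightarrow> length vs = r \<Longrightarrow>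
      \<forall>i<r. good (swap_pt (rotate i vs)) \<Longrightarrow>
      (\<Sum>i<r. Bstar b n r (swap_pt (rotate i vs))) + (if n = 2 * r + 1 then of_nat r * M0 r else 0) = 0"
    unfolding circ_ok_def by blast
  show "\<forall>n r. circ_ok (bihom n r b)"
  proof (intro allI)
    fix n r
    show "circ_ok (bihom n r b)" unfolding circ_ok_def
    proof (intro exI[of _ "\<lambda>r'. if r' = r \<and> n = 2 * r + 1 then M0 r else 0"] allI impI)
      fix r' n' and vs :: "rat list"
      assume *: "1 < r'" "length vs = r'" "\<forall>i<r'. good (swap_pt (rotate i vs))"
      show "(\<Sum>i<r'. Bstar (bihom n r b) n' r' (swap_pt (rotate i vs)))
        + (if n' = 2 * r' + 1 then of_nat r' * (if r' = r \<and> n = 2 * r + 1 then M0 r else 0) else 0) = 0"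
        using M0[OF *, of n'] * by (cases "n' = n \<and> r' = r") (auto simp: Bstar_bihom[OF b])
    qed
  qed
next
  assume "\<forall>n r. circ_ok (bihom n r b)"
  then have "\<forall>n r. \<exists>M0 :: nat \<Rightarrow> rat. \<forall>r' n' vs. 1 < r' \<longrightarrow> length vs = r' \<longrightarrow>
      (\<forall>i<r'. good (swap_pt (rotate i vs))) \<longrightarrow>
      (\<Sum>i<r'. Bstar (bihom n r b) n' r' (swap_pt (rotate i vs))) + (if n' = 2 * r' + 1 then of_nat r' * M0 r' else 0) = 0"
    unfolding circ_ok_def .
  then obtain M :: "nat \<Rightarrow> nat \<Rightarrow> nat \<Rightarrow> rat" where M: "\<And>n r r' n' vs. 1 < r' \<Longrightarrow> length vs = r' \<Longrightarrow>
      \<forall>i<r'. good (swap_pt (rotate i vs)) \<Longrightarrow>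
      (\<Sum>i<r'. Bstar (bihom n r b) n' r' (swap_pt (rotate i vs))) + (if n' = 2 * r' + 1 then of_nat r' * M n r r' else 0) = 0"
    by metis
  show "circ_ok b" unfolding circ_ok_def
  \<comment> \<open>For depth \<open>r\<close> the constant is taken from the only component in
    which it occurs.\<close>
  proof (intro exI[of _ "\<lambda>r. M (2 * r + 1) r r"] allI impI)
    fix r n and vs :: "rat list"
    assume *: "1 < r" "length vs = r" "\<forall>i<r. good (swap_pt (rotate i vs))"
    show "(\<Sum>i<r. Bstar b n r (swap_pt (rotate i vs))) + (if n = 2 * r + 1 then of_nat r * M (2 * r + 1) r r else 0) = 0"
      using M[OF *, of n r n] * by (auto simp: Bstar_bihom[OF b])
  qed
qed

lemma wpush_iff_bihom: "wpush b \<longleftrightarrow> (\<forall>n r. wpush (bihom n r b))"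
proof
  assume "wpush b"
  then show "\<forall>n r. wpush (bihom n r b)" by (simp add: wpush_def bihom_apply add.commute)
next
  assume *: "\<forall>n r. wpush (bihom n r b)"
  show "wpush b" unfolding wpush_def
  proof (intro allI)
    fix k v
    show "b (replicate k False @ True # v) = b (v @ True # replicate k False)"
      using *[rule_format, of "Suc (k + length v)" "Suc (dep v)", unfolded wpush_def, rule_format, of k v]
      by (simp add: bihom_apply)
  qed
qed

lemma bihom_idem: "bihom n r (bihom n r b) = bihom n r b"
  by (auto simp: fun_eq_iff bihom_apply)

lemma krv_ell_iff_bihom: "b \<in> krv_ell \<longleftrightarrow> (\<forall>n r. bihom n r b \<in> krv_ell)"
proof
  assume "b \<in> krv_ell"
  then show "\<forall>n r. bihom n r b \<in> krv_ell"
    using circ_ok_iff_bihom wpush_iff_bihom lieC_bihom unfolding krv_ell_iff by blast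
next
  assume *: "\<forall>n r. bihom n r b \<in> krv_ell"
  then have "b \<in> lieC" using lieC_iff_bihom bihom_idem unfolding krv_ell_iff by metis
  then show "b \<in> krv_ell"
    using * circ_ok_iff_bihom wpush_iff_bihom unfolding krv_ell_iff by blast
qed

lemma krv_ell_add:
  assumes "b \<in> krv_ell" "b' \<in> krv_ell"
  shows "b + b' \<in> krv_ell"
proof -
  have b: "b \<in> lieC" "b' \<in> lieC" and c: "circ_ok b" "circ_ok b'" using assms by (auto simp: krv_ell_iff)
  obtain M :: "nat \<Rightarrow> rat" where M: "\<And>r n vs. 1 < r \<Longrightarrow> length vs = r \<Longrightarrow>
      \<forall>i<r. good (swap_pt (rotate i vs)) \<Longrightarrow>
      (\<Sum>i<r. Bstar b n r (swap_pt (rotate i vs))) + (if n = 2 * r + 1 then of_nat r * M r else 0) = 0"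
    using c(1) unfolding circ_ok_def by blast
  obtain M' :: "nat \<Rightarrow> rat" where M': "\<And>r n vs. 1 < r \<Longrightarrow> length vs = r \<Longrightarrow>
      \<forall>i<r. good (swap_pt (rotate i vs)) \<Longrightarrow>
      (\<Sum>i<r. Bstar b' n r (swap_pt (rotate i vs))) + (if n = 2 * r + 1 then of_nat r * M' r else 0) = 0"
    using c(2) unfolding circ_ok_def by blast
  have "circ_ok (b + b')" unfolding circ_ok_def
  proof (intro exI[of _ "\<lambda>r. M r + M' r"] allI impI)
    fix r n and vs :: "rat list"
    assume *: "1 < r" "length vs = r" "\<forall>i<r. good (swap_pt (rotate i vs))"
    show "(\<Sum>i<r. Bstar (b + b') n r (swap_pt (rotate i vs))) + (if n = 2 * r + 1 then of_nat r * (M r + M' r) else 0) = 0"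
      using M[OF *, of n] M'[OF *, of n] * by (simp add: Bstar_linear(1)[OF b] sum.distrib algebra_simps split: if_splits)
  qed
  moreover have "wpush (b + b')" using assms by (simp add: krv_ell_iff wpush_def pw)
  ultimately show ?thesis using b by (simp add: krv_ell_iff lieC_add)
qed

lemma krv_ell_ssc:
  assumes "b \<in> krv_ell"
  shows "ssc c b \<in> krv_ell"
proof -
  have b: "b \<in> lieC" and circ: "circ_ok b" using assms by (auto simp: krv_ell_iff)
  obtain M :: "nat \<Rightarrow> rat" where M: "\<And>r n vs. 1 < r \<Longrightarrow> length vs = r \<Longrightarrow>
      \<forall>i<r. good (swap_pt (rotate i vs)) \<Longrightarrow>
      (\<Sum>i<r. Bstar b n r (swap_pt (rotate i vs))) + (if n = 2 * r + 1 then of_nat r * M r else 0) = 0"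
    using circ unfolding circ_ok_def by blast
  have "circ_ok (ssc c b)" unfolding circ_ok_def
  proof (intro exI[of _ "\<lambda>r. c * M r"] allI impI)
    fix r n and vs :: "rat list"
    assume *: "1 < r" "length vs = r" "\<forall>i<r. good (swap_pt (rotate i vs))"
    have "(\<Sum>i<r. Bstar (ssc c b) n r (swap_pt (rotate i vs))) + (if n = 2 * r + 1 then of_nat r * (c * M r) else 0)
      = c * ((\<Sum>i<r. Bstar b n r (swap_pt (rotate i vs))) + (if n = 2 * r + 1 then of_nat r * M r else 0))"
      using * by (simp add: Bstar_linear(2)[OF b b] sum_distrib_left algebra_simps)
    then show "(\<Sum>i<r. Bstar (ssc c b) n r (swap_pt (rotate i vs))) + (if n = 2 * r + 1 then of_nat r * (c * M r) else 0) = 0"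
      using M[OF *, of n] by simp
  qed
  moreover have "wpush (ssc c b)" using assms by (simp add: krv_ell_iff wpush_def pw)
  ultimately show ?thesis using b by (simp add: krv_ell_iff lieC_ssc)
qed

lemma krv_ell_zero: "0 \<in> krv_ell"
proof -
  have "circ_ok 0" unfolding circ_ok_def
    by (intro exI[of _ "\<lambda>_. 0"]) (simp add: Bstar_linear(3)[OF lieC_zero lieC_zero])
  then show ?thesis by (simp add: krv_ell_iff lieC_zero wpush_def pw)
qed

section \<open>Closure under the bracket\<close>

lemma krv_ell_partner:
  assumes "b \<in> krv_ell"
  shows "partner b \<in> lieC" "is_oder2 (der b (partner b))" "sbr sX (partner b) = sbr sY b"
    "b [] = 0" "partner b [] = 0"
  using assms partner_props[of b] lieC_Nil[of b] lieC_Nil[of "partner b"] by (auto simp: krv_ell_iff)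

lemma der_sbr_sX_sY:
  assumes "b [] = 0" "a [] = 0"
  shows "der b a (sbr sX sY) = sbr sX a - sbr sY b"
  using assms by (simp add: der_sbr sX_eq sY_eq der_ltr) (simp add: sbr_eq)

text \<open>The derivation kills \<open>[x,y]\<close>, hence all its powers. A single coefficient
  only involves finitely many of them, which settles the infinite sum.\<close>

lemma der_spow_series:
  assumes "b [] = 0" "a [] = 0" "sbr sX a = sbr sY b"
  shows "der b a (spow_series N) = 0"
proof
  fix v
  have D: "der b a (spow r) = 0" for r
    using assms by (induction r) (simp_all add: der_sone der_smul der_sbr_sX_sY)
  have short: "spow r u = 0" if "length u < r" for r u
    using that bideg_spow[of r] by (auto simp: bideg_def)
  have "der b a (spow_series N) v = der b a (\<Sum>r\<le>length v. ssc (N r) (spow r)) v"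
  proof (rule der_cong_le)
    fix u :: word assume u: "length u \<le> length v"
    show "spow_series N u = (\<Sum>r\<le>length v. ssc (N r) (spow r)) u"
      unfolding spow_series_def sum_apply using u
      by (intro sum.mono_neutral_cong_left) (auto simp: pw short)
  qed auto
  also have "\<dots> = 0" by (simp add: der_sum der_ssc D ssc_simps pw)
  finally show "der b a (spow_series N) v = 0 v" by (simp add: pw)
qed

lemma kbr_krv_ell:
  assumes b: "b \<in> krv_ell" and b': "b' \<in> krv_ell"
  shows "kbr b b' \<in> krv_ell"
    and "partner (kbr b b') = der b (partner b) (partner b') - der b' (partner b') (partner b)"
proof -
  define a where "a = partner b"
  define a' where "a' = partner b'"
  define c where "c = der b a b' - der b' a' b"
  define d where "d = der b a a' - der b' a' a"
  note p = krv_ell_partner[OF b, folded a_def] and p' = krv_ell_partner[OF b', folded a'_def]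
  have lie: "b \<in> lieC" "b' \<in> lieC" and push: "wpush b" "wpush b'" and circ: "circ_ok b" "circ_ok b'"
    using b b' by (auto simp: krv_ell_iff)
  have kbr: "kbr b b' = c" by (simp add: kbr_def ssub_eq c_def a_def a'_def)
  have c_lie: "c \<in> lieC" and d_lie: "d \<in> lieC"
    unfolding c_def d_def using lie p p' by (auto intro!: lieC_diff der_lieC)
  have rel: "sbr sX d = sbr sY c"
  proof -
    \<comment> \<open>\<open>D_(c,d)\<close> is the commutator of two derivations that kill
      \<open>[x,y]\<close>, so it kills \<open>[x,y]\<close> too; this says that \<open>d\<close> is
      the partner of \<open>c\<close>.\<close>
    have "der c d (sbr sX sY) = der b a (der b' a' (sbr sX sY)) - der b' a' (der b a (sbr sX sY))"
      unfolding c_def d_def using p p' by (subst der_commutator) auto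
    also have "\<dots> = 0" using p p' by (simp add: der_sbr_sX_sY)
    finally show ?thesis using c_lie d_lie by (simp add: der_sbr_sX_sY lieC_Nil)
  qed
  have divergence: "rder False e + rder True f = rder False e - lder False e" if "sbr sX f = sbr sY e" for e f
    using partner_relations(2)[OF that] by (simp add: fun_eq_iff pw)
  have cyc_D: "cyc (der b1 a1 (rder False b2 + rder True a2)) = 0"
    if h: "b1 [] = 0" "a1 [] = 0" "sbr sX a1 = sbr sY b1" "b2 \<in> lieC" "wpush b2" "circ_ok b2" "sbr sX a2 = sbr sY b2"
    for b1 a1 b2 a2
  proof -
    obtain N where N: "cyc (rder False b2 - lder False b2) = cyc (spow_series N)"
      using circ_ok_imp_cyc[OF h(4-6)] by blast
    define e where "e = rder False b2 + rder True a2"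
    \<comment> \<open>The divergence itself is nonzero on cyclic words in general. Subtracting the
      series in \<open>[x,y]\<close> makes \<open>cyc_der_zero\<close> applicable, and that series
      is killed by the derivation.\<close>
    have "cyc (e - spow_series N) = 0" unfolding e_def divergence[OF h(7)] using N by (simp add: cyc_simps)
    then have "cyc (der b1 a1 (e - spow_series N)) = 0" using h by (intro cyc_der_zero) auto
    then show ?thesis using h by (simp add: der_diff der_spow_series flip: e_def)
  qed
  have "cyc (rder False c - lder False c) = cyc (rder False c + rder True d)"
    by (simp only: divergence[OF rel])
  also have "\<dots> = 0"
    unfolding c_def d_def using p p' lie push circ by (subst cyc_divergence_cocycle) (auto simp: cyc_D)
  finally have "circ_ok c" using c_lie partner_imp_wpush[OF rel] by (intro cyc_zero_imp_circ_ok)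
  then show "kbr b b' \<in> krv_ell"
    using c_lie partner_imp_wpush[OF rel] by (simp add: kbr krv_ell_iff)
  show "partner (kbr b b') = der b (partner b) (partner b') - der b' (partner b') (partner b)"
    unfolding kbr using partner_eqI[OF c_lie d_lie rel] by (simp add: d_def a_def a'_def)
qed

lemma Phi_kbr:
  assumes "b \<in> krv_ell" "b' \<in> krv_ell"
  shows "Phi (kbr b b') f = Phi b (Phi b' f) - Phi b' (Phi b f)"
  unfolding Phi_def kbr_krv_ell(2)[OF assms] using krv_ell_partner[OF assms(1)] krv_ell_partner[OF assms(2)]
  by (subst der_commutator) (simp_all add: kbr_def ssub_eq)

section \<open>Linearity and injectivity of the map to derivations\<close>

lemma partner_add: "b \<in> krv_ell \<Longrightarrow> b' \<in> krv_ell \<Longrightarrow> partner (b + b') = partner b + partner b'"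
  using krv_ell_partner[of b] krv_ell_partner[of b']
  by (intro partner_eqI) (auto simp: krv_ell_iff lieC_add sbr_add)

lemma partner_ssc: "b \<in> krv_ell \<Longrightarrow> partner (ssc c b) = ssc c (partner b)"
  using krv_ell_partner[of b] by (intro partner_eqI) (auto simp: krv_ell_iff lieC_ssc sbr_ssc)

text \<open>The sum of two derivations is a derivation, hence determined by its values on x and y,
  where additivity of the partner applies.\<close>

lemma Phi_add:
  assumes "b \<in> krv_ell" "b' \<in> krv_ell"
  shows "Phi (b + b') f = Phi b f + Phi b' f"
proof -
  note p = krv_ell_partner[OF assms(1)] krv_ell_partner[OF assms(2)]
  let ?T = "\<lambda>f. der b (partner b) f + der b' (partner b') f"
  have "?T f = der (?T sX) (?T sY) f"
    by (rule derivation_eq_der[of ?T])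
       (simp_all add: der_add der_ssc der_smul smul_simps p sX_eq sY_eq der_ltr pw(1))
  then show ?thesis by (simp add: Phi_def partner_add assms sX_eq sY_eq der_ltr p)
qed

lemma Phi_ssc:
  assumes "b \<in> krv_ell"
  shows "Phi (ssc c b) f = ssc c (Phi b f)"
proof -
  note p = krv_ell_partner[OF assms]
  let ?T = "\<lambda>f. ssc c (der b (partner b) f)"
  have "?T f = der (?T sX) (?T sY) f"
    by (rule derivation_eq_der[of ?T])
       (simp_all add: der_add der_ssc der_smul smul_simps p sX_eq sY_eq der_ltr pw(5) mult.commute)
  then show ?thesis by (simp add: Phi_def partner_ssc assms sX_eq sY_eq der_ltr p)
qed

lemma sX_lie2: "sX \<in> lie2"
proof -
  have "hom n sX \<in> liepoly" for n
  proof -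
    have "hom n sX = ssc (if n = 1 then 1 else 0) sX"
      by (auto simp: fun_eq_iff hom_apply sX_eq smono_apply pw)
    then show ?thesis by (metis liepoly.lp_sc liepoly.lp_X)
  qed
  then show ?thesis by (simp add: lie2_def)
qed

text \<open>Evaluation at x recovers \<open>b\<close>, which gives injectivity.\<close>

lemma Phi_sX: "b \<in> krv_ell \<Longrightarrow> Phi b sX = b"
  using krv_ell_partner[of b] by (simp add: Phi_def sX_eq der_ltr)

theorem theorem5:
  shows "(\<forall>b. b \<in> krv_ell \<longleftrightarrow> (\<forall>n r. bihom n r b \<in> krv_ell))
    \<and> (\<forall>b\<in>krv_ell. \<exists>!a. a \<in> lieC \<and> is_oder2 (der b a))
    \<and> szero \<in> krv_ell
    \<and> (\<forall>b\<in>krv_ell. \<forall>b'\<in>krv_ell. \<forall>c. sadd b b' \<in> krv_ell \<and> ssc c b \<in> krv_ell)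
    \<and> (\<forall>b\<in>krv_ell. is_oder2 (Phi b))
    \<and> (\<forall>b\<in>krv_ell. \<forall>b'\<in>krv_ell. (\<forall>f\<in>lie2. Phi b f = Phi b' f) \<longrightarrow> b = b')
    \<and> (\<forall>b\<in>krv_ell. \<forall>b'\<in>krv_ell. \<forall>c. \<forall>f\<in>lie2.
          Phi (sadd b b') f = sadd (Phi b f) (Phi b' f) \<and> Phi (ssc c b) f = ssc c (Phi b f))
    \<and> (\<forall>b\<in>krv_ell. \<forall>b'\<in>krv_ell. kbr b b' \<in> krv_ell \<and>
          (\<forall>f\<in>lie2. Phi (kbr b b') f = ssub (Phi b (Phi b' f)) (Phi b' (Phi b f))))"
  unfolding sadd_eq ssub_eq szero_eq
proof (intro conjI ballI allI impI)
  fix b b' assume "b \<in> krv_ell" "b' \<in> krv_ell" "\<forall>f\<in>lie2. Phi b f = Phi b' f"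
  then show "b = b'" using Phi_sX sX_lie2 by metis
next
  fix b assume "b \<in> krv_ell"
  then show "\<exists>!a. a \<in> lieC \<and> is_oder2 (der b a)" by (simp add: krv_ell_iff ex1_partner)
  show "is_oder2 (Phi b)" unfolding Phi_def using \<open>b \<in> krv_ell\<close> by (rule krv_ell_partner)
qed (simp_all only: krv_ell_zero krv_ell_add krv_ell_ssc Phi_add Phi_ssc kbr_krv_ell Phi_kbr flip: krv_ell_iff_bihom)

end
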